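(* For each $k\in\{12,16,18,20,22,26\}$, let $\Delta_k=\sum_{n>0}a_n(\Delta_k)q^n$ be the unique (normalized) cusp form of level $1$ and weight $k$. Then the smallest $n\ge 1$ for which $a_n(\Delta_k)=0$ must be a prime; that is, if the set $\{n\ge 1: a_n(\Delta_k)=0\}$ is nonempty, then its least element is a prime number.
   Context: Here $q=e^{2\pi i z}$. For $k\in\{12,16,18,20,22,26\}$ the space $S_k(SL_2(\mathbb{Z}))$ of cusp forms of weight $k$ for $SL_2(\mathbb{Z})$ is one-dimensional, and $\Delta_k$ denotes its unique element normalized by $a_1(\Delta_k)=1$; its Fourier coefficients are integers. *)

theory Defs
  imports "HOL-Complex_Analysis.Complex_Analysis" "HOL-Computational_Algebra.Primes"
begin

definition upper_half_plane :: "complex set" where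
  "upper_half_plane = {z. Im z > 0}"

text \<open>
  The sequence \<open>a\<close> is the Fourier expansion of \<open>f\<close> at the cusp at infinity, in powers of
  \<open>q = exp (2 * pi * \<i> * z)\<close>. By uniqueness of power series coefficients on the punctured
  unit disc there is at most one such \<open>a\<close>. Since only nonnegative exponents occur, the
  existence of \<open>a\<close> expresses that \<open>f\<close> is holomorphic at infinity.
\<close>

definition has_q_expansion :: "(complex \<Rightarrow> complex) \<Rightarrow> (nat \<Rightarrow> complex) \<Rightarrow> bool" where
  "has_q_expansion f a \<longleftrightarrow>
     (\<forall>z\<in>upper_half_plane. (\<lambda>n. a n * exp (2 * of_real pi * \<i> * z) ^ n) sums f z)"

text \<open>
  Values of a modular form outside the upper half plane are irrelevant, so the sets below
  contain every extension of a form to a function on the complex numbers.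
\<close>

definition modular_forms :: "nat \<Rightarrow> (complex \<Rightarrow> complex) set" where
  "modular_forms k = {f.
     f holomorphic_on upper_half_plane \<and>
     (\<forall>a b c d :: int. a * d - b * c = 1 \<longrightarrow>
        (\<forall>z\<in>upper_half_plane.
           f ((of_int a * z + of_int b) / (of_int c * z + of_int d)) =
             (of_int c * z + of_int d) ^ k * f z)) \<and>
     (\<exists>a. has_q_expansion f a)}"

definition cusp_forms :: "nat \<Rightarrow> (complex \<Rightarrow> complex) set" where
  "cusp_forms k = {f \<in> modular_forms k. \<exists>a. has_q_expansion f a \<and> a 0 = 0}"

end

(*
  Proof idea. If f is a nonzero form of weight 2n vanishing to order m at the cusp, then
  |f(z)| Im(z)^n attains its maximum over the upper half-plane, and the maximum principle for
  f / q^m puts the maximum at height at most n / (2 pi m), whereas some equivalent point has height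
  at least sqrt(3)/2. This bounds the order of vanishing without the valence formula. In weights 22
  and 26 a little more is needed: the forced zeros at i and rho keep the maximum away by a Schwarz
  lemma.

  Hence the Hecke operators act on Delta_k by scalars, which gives the multiplicative recursion for
  its coefficients, and they act by scalars on G_4, G_6, G_4^2 and G_4 G_6, which determines the
  normalized Eisenstein series E_4 = 1 + 240 A and E_6 = 1 - 504 B without summing G_4 and G_6.
  Since A = B mod 12, the cusp form (E_4^3 - E_6^2) / 1728 is integral, so is its product
  Delta_k = (E_4^3 - E_6^2) E_4^i E_6^j / 1728, and Delta_k is congruent mod 6 to Delta_12.

  By multiplicativity the first zero is at a prime power p^m. If m > 1, then a_p is nonzero, and size
  and p-adic valuation force a_p^2 = p^k with p = 2 or p = 3; but 3 divides a_2 and 2 divides a_3.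
*)
theory Submission
  imports Defs
begin

section \<open>Expansions at the cusp\<close>

text \<open>The height \<open>n / (2 * pi * m)\<close> lies below \<open>sqrt 3 / 2\<close> exactly
  when \<open>n / m < pi * sqrt 3\<close>, about 5.44. For m = 1 this reaches weight 10, just far
  enough for E_4^2 and E_4 E_6, whose eigenvalue equations tie the coefficients of E_4 and E_6
  together. For m = 2 it reaches weight 20; the quotients 11/2 and 13/2 belonging to weights 22 and
  26 exceed the threshold. Order 2 is the right order because T_p Delta_k - a_p Delta_k and the
  difference of Delta_k and the explicit product both have zero coefficients at 0 and 1.

  The exceptional case a_p^2 = p^k is genuine for the recursion: with p = 2 it vanishes at index 3,
  with p = 3 at index 5. It is therefore excluded by information on the actual values a_2 and a_3,
  and this is the purpose of the congruence mod 6.\<close>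

definition nome :: "complex \<Rightarrow> complex" where
  "nome z = exp (2 * of_real pi * \<i> * z)"

lemma norm_nome: "norm (nome z) = exp (- (2 * pi * Im z))"
  by (simp add: nome_def)

lemma nome_nonzero [simp]: "nome z \<noteq> 0"
  by (simp add: nome_def)

lemma norm_nome_less_1: "z \<in> upper_half_plane \<Longrightarrow> norm (nome z) < 1"
  by (simp add: norm_nome upper_half_plane_def)

lemma nome_add_of_int [simp]: "nome (z + of_int m) = nome z"
proof -
  have "nome (z + of_int m) = nome z * exp (2 * of_int m * of_real pi * \<i>)"
    by (simp add: nome_def exp_add [symmetric] algebra_simps)
  also have "exp (2 * of_int m * of_real pi * \<i>) = (1 :: complex)"
    using exp_integer_2pi [of "of_int m"] by simp
  finally show ?thesis by simp
qed

lemma nome_preimage: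
  assumes "q \<noteq> 0" "norm q < 1"
  shows "Ln q / (2 * of_real pi * \<i>) \<in> upper_half_plane"
    and "nome (Ln q / (2 * of_real pi * \<i>)) = q"
    and "Im (Ln q / (2 * of_real pi * \<i>)) = - ln (norm q) / (2 * pi)"
proof -
  show *: "Im (Ln q / (2 * of_real pi * \<i>)) = - ln (norm q) / (2 * pi)"
    using assms by (simp add: Im_divide power2_eq_square field_simps)
  have "ln (norm q) < 0" using assms by simp
  then show "Ln q / (2 * of_real pi * \<i>) \<in> upper_half_plane"
    unfolding upper_half_plane_def mem_Collect_eq * by (simp add: divide_neg_pos)
  show "nome (Ln q / (2 * of_real pi * \<i>)) = q"
    using assms by (simp add: nome_def)
qed

lemma has_q_expansion_nome:
  "has_q_expansion f a \<longleftrightarrow> (\<forall>z\<in>upper_half_plane. (\<lambda>n. a n * nome z ^ n) sums f z)"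
  by (simp add: has_q_expansion_def nome_def)

text \<open>Convergence is given at values of \<open>nome\<close> only. A real \<open>r\<close>
  between \<open>norm q\<close> and 1 is such a value, so the estimate also covers
  \<open>q = 0\<close>, which is not one.\<close>

lemma q_expansion_summable:
  assumes "has_q_expansion f a" "norm q < 1"
  shows "summable (\<lambda>n. norm (a n * q ^ n))"
proof -
  obtain r where r: "norm q < r" "r < 1" using dense [OF assms(2)] by blast
  have r0: "0 < r" using r(1) norm_ge_zero [of q] by linarith
  define z where "z = Ln (complex_of_real r) / (2 * of_real pi * \<i>)"
  have z: "z \<in> upper_half_plane" "nome z = of_real r"
    using nome_preimage [of "of_real r"] r r0 by (auto simp: z_def)
  have "summable (\<lambda>n. a n * (of_real r :: complex) ^ n)"
    using assms(1) z by (auto simp: has_q_expansion_nome sums_iff)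
  then show ?thesis
    by (rule powser_insidea) (use r r0 in simp)
qed

lemma q_expansion_sums:
  assumes "has_q_expansion f a" "norm q < 1"
  shows "(\<lambda>n. a n * q ^ n) sums (\<Sum>n. a n * q ^ n)"
  by (rule summable_sums [OF summable_norm_cancel [OF q_expansion_summable [OF assms]]])

lemma q_expansion_tendsto:
  assumes "has_q_expansion f a"
  shows "((\<lambda>y. f (of_real y * \<i>)) \<longlongrightarrow> a 0) at_top"
proof -
  define g where "g = (\<lambda>q. \<Sum>n. a n * q ^ n)"
  have "(g \<longlongrightarrow> a 0) (at 0)"
    by (rule powser_limit_0_strong [of 1]) (auto simp: g_def intro: q_expansion_sums [OF assms])
  moreover have "filterlim (\<lambda>y::real. nome (of_real y * \<i>)) (at 0) at_top"
  proof -
    have "((\<lambda>y::real. exp (- (2 * pi * y))) \<longlongrightarrow> 0) at_top"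
      by (rule filterlim_compose [OF exp_at_bot])
         (rule filterlim_compose [OF filterlim_uminus_at_bot_at_top],
          rule filterlim_tendsto_pos_mult_at_top [OF tendsto_const _ filterlim_ident], simp)
    then have "((\<lambda>y::real. nome (of_real y * \<i>)) \<longlongrightarrow> 0) at_top"
      by (subst tendsto_norm_zero_iff [symmetric]) (simp add: norm_nome)
    then show ?thesis by (simp add: filterlim_at)
  qed
  ultimately have "((\<lambda>y. g (nome (of_real y * \<i>))) \<longlongrightarrow> a 0) at_top"
    by (rule filterlim_compose)
  then show ?thesis
  proof (rule Lim_transform_eventually)
    show "\<forall>\<^sub>F y in at_top. g (nome (of_real y * \<i>)) = f (of_real y * \<i>)"
      using eventually_gt_at_top [of 0]
    proof eventually_elim
      case (elim y)
      then show ?case using assms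
        by (auto simp: has_q_expansion_nome g_def upper_half_plane_def sums_iff)
    qed
  qed
qed

text \<open>Zeros of a nonzero power series are isolated. That fact is applied to a series without
  constant term, so \<open>a 0\<close> is first removed by a limit at 0.\<close>

lemma q_expansion_of_zero:
  assumes "has_q_expansion f a" and "\<And>z. z \<in> upper_half_plane \<Longrightarrow> f z = 0"
  shows "a n = 0"
proof -
  define g where "g = (\<lambda>q. \<Sum>n. a n * q ^ n)"
  have g0: "g q = 0" if "q \<noteq> 0" "norm q < 1" for q
    using nome_preimage [OF that] assms by (auto simp: has_q_expansion_nome g_def sums_iff)
  have "(g \<longlongrightarrow> a 0) (at 0)"
    by (rule powser_limit_0_strong [of 1]) (auto simp: g_def intro: q_expansion_sums [OF assms(1)])
  moreover have "(g \<longlongrightarrow> 0) (at 0)"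
    by (rule tendsto_eventually) (auto simp: eventually_at dist_norm intro!: exI [of _ 1] g0)
  ultimately have a0: "a 0 = 0"
    using tendsto_unique trivial_limit_at by blast
  show ?thesis
  proof (rule ccontr)
    assume an: "a n \<noteq> 0"
    with a0 have "n > 0" by (cases n) auto
    have sm: "\<And>x. norm (x - 0) < 1 \<Longrightarrow> (\<lambda>n. a n * (x - 0) ^ n) sums g x"
      using q_expansion_sums [OF assms(1)] by (simp add: g_def)
    have g00: "g 0 = 0" by (simp add: g_def a0)
    obtain s where s: "0 < s" "\<And>z. z \<in> cball 0 s - {0} \<Longrightarrow> g z \<noteq> 0"
      using powser_0_nonzero [OF zero_less_one sm g00 an \<open>n > 0\<close>] by blast
    show False
    proof -
      define t where "t = min s (1/2)"
      have t: "0 < t" "t \<le> s" "t < 1" using s(1) by (auto simp: t_def)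
      then show False using s(2) [of "of_real t"] g0 [of "of_real t"] by simp
    qed
  qed
qed

lemma has_q_expansion_cmult:
  "has_q_expansion f a \<Longrightarrow> has_q_expansion (\<lambda>z. c * f z) (\<lambda>n. c * a n)"
  by (auto simp: has_q_expansion_def mult.assoc intro!: sums_mult)

lemma has_q_expansion_diff:
  "has_q_expansion f a \<Longrightarrow> has_q_expansion g b \<Longrightarrow> has_q_expansion (\<lambda>z. f z - g z) (\<lambda>n. a n - b n)"
  by (auto simp: has_q_expansion_def left_diff_distrib intro!: sums_diff)

lemma has_q_expansion_mult:
  assumes "has_q_expansion f a" "has_q_expansion g b"
  shows "has_q_expansion (\<lambda>z. f z * g z) (\<lambda>n. \<Sum>i\<le>n. a i * b (n - i))"
  unfolding has_q_expansion_nome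
proof
  fix z assume z: "z \<in> upper_half_plane"
  note q = norm_nome_less_1 [OF z]
  have "(\<lambda>k. \<Sum>i\<le>k. (a i * nome z ^ i) * (b (k - i) * nome z ^ (k - i))) sums
      ((\<Sum>k. a k * nome z ^ k) * (\<Sum>k. b k * nome z ^ k))"
    by (intro Cauchy_product_sums q_expansion_summable [OF assms(1) q] q_expansion_summable [OF assms(2) q])
  moreover have "(\<Sum>i\<le>k. (a i * nome z ^ i) * (b (k - i) * nome z ^ (k - i))) =
      (\<Sum>i\<le>k. a i * b (k - i)) * nome z ^ k" for k
    unfolding sum_distrib_right
    by (intro sum.cong refl) (simp add: power_add [symmetric] mult_ac)
  ultimately show "(\<lambda>n. (\<Sum>i\<le>n. a i * b (n - i)) * nome z ^ n) sums (f z * g z)"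
    using assms z by (simp add: has_q_expansion_nome sums_iff)
qed

lemma q_expansion_unique:
  assumes "has_q_expansion f a" "has_q_expansion f b"
  shows "a = b"
proof
  fix n
  have "a n - b n = 0"
    by (rule q_expansion_of_zero [OF has_q_expansion_diff [OF assms]]) simp
  then show "a n = b n" by simp
qed

text \<open>A series in \<open>nome z\<close> does not see integer translations. Hence the vanishing
  lemmas below assume, besides an expansion, only the rule for \<open>- 1 / z\<close>, and this is
  all that is checked for Hecke images.\<close>

lemma q_expansion_add_of_int:
  assumes "has_q_expansion f a" "z \<in> upper_half_plane"
  shows "f (z + of_int m) = f z"
proof -
  have "z + of_int m \<in> upper_half_plane" using assms(2) by (simp add: upper_half_plane_def)
  then show ?thesis
    using assms nome_add_of_int [of z m] sums_unique2 unfolding has_q_expansion_nome by metis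
qed

lemma q_expansion_holomorphic:
  assumes "has_q_expansion f a"
  shows "f holomorphic_on upper_half_plane"
proof -
  define g where "g = (\<lambda>q. \<Sum>n. a n * q ^ n)"
  have "g holomorphic_on ball 0 1"
    by (rule power_series_holomorphic [where a = a]) (simp add: g_def q_expansion_sums [OF assms])
  then have "(g \<circ> nome) holomorphic_on upper_half_plane"
  proof (rule holomorphic_on_compose_gen [rotated])
    show "nome holomorphic_on upper_half_plane"
      unfolding nome_def [abs_def] by (intro holomorphic_intros)
    show "nome ` upper_half_plane \<subseteq> ball 0 1"
      using norm_nome_less_1 by auto
  qed
  then show ?thesis
  proof (rule holomorphic_transform)
    fix z assume "z \<in> upper_half_plane"
    then have "(\<lambda>n. a n * nome z ^ n) sums f z"
      using assms by (simp add: has_q_expansion_nome)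
    then show "(g \<circ> nome) z = f z" by (simp add: g_def sums_iff)
  qed
qed

section \<open>Forms vanishing to high order at the cusp\<close>

lemma minus_inverse_in_upper_half_plane:
  "z \<in> upper_half_plane \<Longrightarrow> - 1 / z \<in> upper_half_plane"
  by (auto simp: upper_half_plane_def Im_divide zero_less_divide_iff add_nonneg_pos)

lemma Im_minus_inverse: "Im (- 1 / z) = Im z / (norm z)\<^sup>2"
  by (simp add: Im_divide cmod_power2)

lemma add_of_int_in_upper_half_plane:
  "z \<in> upper_half_plane \<Longrightarrow> z + of_int m \<in> upper_half_plane"
  by (simp add: upper_half_plane_def)

lemma translate_to_strip:
  obtains m :: int where "\<bar>Re (z + of_int m)\<bar> \<le> 1/2"
proof
  show "\<bar>Re (z + of_int (- round (Re z)))\<bar> \<le> 1/2"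
    using of_int_round_abs_le [of "Re z"] by (simp add: abs_minus_commute)
qed

text \<open>Inversion raises low points of the strip by a fixed factor; a point that is high
  already is brought into the domain by at most one inversion and one translation.\<close>

lemma fundamental_domain:
  assumes "z \<in> upper_half_plane" "P z"
    and inv: "\<And>z. z \<in> upper_half_plane \<Longrightarrow> P z \<Longrightarrow> P (- 1 / z)"
    and shift: "\<And>z m. z \<in> upper_half_plane \<Longrightarrow> P z \<Longrightarrow> P (z + of_int m)"
  obtains w where "w \<in> upper_half_plane" "P w" "\<bar>Re w\<bar> \<le> 1/2" "1 \<le> norm w"
proof -
  \<comment> \<open>A point of the strip below height 17/20 has squared norm at most 1/4 + 289/400 <
    50/51, so inversion raises it by the factor 51/50 at least; \<open>n\<close> counts the
    inversions still available.\<close>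
  have high: "\<exists>w\<in>upper_half_plane. P w \<and> \<bar>Re w\<bar> \<le> 1/2 \<and> 17/20 \<le> Im w"
    if "z \<in> upper_half_plane" "P z" "17/20 \<le> Im z * (51/50) ^ n" for n z
    using that
  proof (induction n arbitrary: z)
    case 0
    obtain m where "\<bar>Re (z + of_int m)\<bar> \<le> 1/2" by (rule translate_to_strip)
    then show ?case
      using 0 shift [of z m] add_of_int_in_upper_half_plane [of z m]
      by (intro bexI [of _ "z + of_int m"]) auto
  next
    case (Suc n)
    obtain m where m: "\<bar>Re (z + of_int m)\<bar> \<le> 1/2" by (rule translate_to_strip)
    define w where "w = z + of_int m"
    have w: "w \<in> upper_half_plane" "P w" "Im w = Im z" "\<bar>Re w\<bar> \<le> 1/2"
      using Suc.prems m shift [of z m] add_of_int_in_upper_half_plane [of z m] by (auto simp: w_def)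
    show ?case
    proof (cases "17/20 \<le> Im w")
      case True
      then show ?thesis using w by auto
    next
      case False
      have pos: "0 < Im w" using w by (simp add: upper_half_plane_def)
      have "(Re w)\<^sup>2 \<le> (1/2)\<^sup>2" using w(4) by (metis abs_le_square_iff abs_of_pos half_gt_zero_iff zero_less_one)
      moreover have "(Im w)\<^sup>2 \<le> (17/20)\<^sup>2" using False pos by (intro power_mono) auto
      ultimately have "(norm w)\<^sup>2 \<le> 50/51"
        unfolding cmod_power2 by (simp add: power2_eq_square)
      moreover have n0: "0 < (norm w)\<^sup>2" using pos by auto
      ultimately have "Im w * (51/50) \<le> Im w / (norm w)\<^sup>2"
        using pos by (simp add: field_simps)
      then have "Im w * (51/50) * (51/50) ^ n \<le> Im (- 1 / w) * (51/50) ^ n"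
        unfolding Im_minus_inverse by (rule mult_right_mono) simp
      then have "17/20 \<le> Im (- 1 / w) * (51/50) ^ n"
        using Suc.prems(3) w(3) by (simp add: mult_ac)
      then show ?thesis
        using Suc.IH [of "- 1 / w"] w inv [of w] minus_inverse_in_upper_half_plane [of w] by blast
    qed
  qed
  obtain n where "17/20 / Im z < (51/50) ^ n"
    using real_arch_pow [of "51/50"] by auto
  then have "17/20 \<le> Im z * (51/50) ^ n"
    using assms(1) by (simp add: upper_half_plane_def field_simps)
  then obtain w where w: "w \<in> upper_half_plane" "P w" "\<bar>Re w\<bar> \<le> 1/2" "17/20 \<le> Im w"
    using high [OF assms(1,2)] by blast
  show thesis
  proof (cases "1 \<le> norm w")
    case True
    then show ?thesis using that w by blast
  next
    case False
    define s where "s = (norm w)\<^sup>2"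
    define v where "v = - 1 / w"
    have w0: "w \<noteq> 0" using w(4) by auto
    have sx: "s = (Re w)\<^sup>2 + (Im w)\<^sup>2" by (simp add: s_def cmod_power2)
    have s1: "s < 1" using False by (simp add: s_def power_less_one_iff)
    have "(17/20)\<^sup>2 \<le> (Im w)\<^sup>2" using w(4) by (intro power_mono) auto
    then have s2: "7/10 \<le> s" by (simp add: sx power2_eq_square add_increasing)
    have v: "v \<in> upper_half_plane" "P v"
      using w inv [of w] minus_inverse_in_upper_half_plane [of w] by (auto simp: v_def)
    have Rev: "Re v = - Re w / s" by (simp add: v_def Re_divide sx)
    have nv: "(norm v)\<^sup>2 = 1 / s" by (simp add: v_def s_def norm_divide power_divide)
    show ?thesis
    proof (cases "\<bar>Re v\<bar> \<le> 1/2")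
      case True
      have "1 \<le> (norm v)\<^sup>2" using s1 s2 unfolding nv by simp
      then show ?thesis using that [OF v True] power_le_one_iff [of "norm v" 2]
        by (metis norm_ge_zero one_le_power power_one linorder_le_cases pos2 power_mono_iff zero_le_one)
    next
      case False
      \<comment> \<open>One unit towards the imaginary axis: since \<open>\<bar>Re v\<bar>\<close>
        is between 1/2 and 5/7, this lands in the strip, and the norm stays at least 1 because
        \<open>w\<close> lies in the strip.\<close>
      define e :: int where "e = (if Re v > 0 then - 1 else 1)"
      have absv: "\<bar>Re v\<bar> = \<bar>Re w\<bar> / s" using s2 by (simp add: Rev)
      have "\<bar>Re v\<bar> \<le> (1/2) / (7/10)"
        unfolding absv using w(3) s2 by (intro frac_le) auto
      then have R: "\<bar>Re (v + of_int e)\<bar> \<le> 1/2"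
        using False by (auto simp: e_def)
      have e2: "(Re v + of_int e)\<^sup>2 = (Re v)\<^sup>2 - 2 * \<bar>Re v\<bar> + 1"
        by (auto simp: e_def power2_eq_square algebra_simps)
      have "(norm (v + of_int e))\<^sup>2 = (norm v)\<^sup>2 - 2 * \<bar>Re v\<bar> + 1"
        by (simp add: cmod_power2 e2)
      also have "\<dots> = (1 - 2 * \<bar>Re w\<bar>) / s + 1"
        unfolding nv absv by (simp add: diff_divide_distrib)
      also have "\<dots> \<ge> 1" using w(3) s2 by simp
      finally have "1 \<le> norm (v + of_int e)"
        by (metis norm_ge_zero power_one pos2 power_mono_iff zero_le_one)
      then show ?thesis
        using that [OF add_of_int_in_upper_half_plane [OF v(1)] shift [OF v] R] by blast
    qed
  qed
qed

section \<open>The maximum principle at the cusp\<close>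

text \<open>The stationary point of \<open>y ^ n * exp (- (c * y))\<close> is \<open>n / c\<close>.
  Beyond it the drop is the n-th power of \<open>1 + t < exp t\<close> at
  \<open>t = y / y' - 1\<close>.\<close>

lemma power_times_exp_decreasing:
  fixes y y' c :: real and n :: nat
  assumes "0 < n" "0 < c" "y' = real n / c" "y' < y"
  shows "y ^ n * exp (- (c * y)) < y' ^ n * exp (- (c * y'))"
proof -
  have y': "0 < y'" using assms by simp
  have "y / y' < exp (y / y' - 1)"
  proof -
    have "0 < y / y' - 1" using assms(4) y' by (simp add: field_simps)
    then show ?thesis
      using exp_lower_Taylor_quadratic [of "y / y' - 1"] zero_less_power [of "y / y' - 1" 2]
      by linarith
  qed
  then have "(y / y') ^ n < exp (y / y' - 1) ^ n"
    using y' less_trans [OF y' assms(4)] assms(1) by (intro power_strict_mono divide_nonneg_pos) auto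
  also have "exp (y / y' - 1) ^ n = exp (real n * (y / y' - 1))"
    by (rule exp_of_nat_mult [symmetric])
  also have "real n * (y / y' - 1) = c * y - c * y'"
  proof -
    have "real n = c * y'" using assms by simp
    then show ?thesis using y' by (simp add: field_simps)
  qed
  finally show ?thesis
    using y' by (simp add: exp_diff exp_minus power_divide field_simps)
qed

text \<open>If \<open>f\<close> vanishes to order \<open>m\<close> at the cusp, then the largest value of \<open>f / q ^ m\<close> on a
  horizontal line increases as the line descends.\<close>

lemma maximum_height:
  fixes m n :: nat
  assumes h: "h holomorphic_on ball 0 1"
    and f: "\<And>z. z \<in> upper_half_plane \<Longrightarrow> f z = nome z ^ m * h (nome z)"
    and mn: "0 < m" "0 < n"
    and z0: "z0 \<in> upper_half_plane" "f z0 \<noteq> 0"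
    and max: "\<And>z. z \<in> upper_half_plane \<Longrightarrow> norm (f z) * Im z ^ n \<le> norm (f z0) * Im z0 ^ n"
  shows "Im z0 \<le> n / (2 * pi * m)"
proof (rule ccontr)
  define y where "y = real n / (2 * pi * m)"
  assume "\<not> ?thesis"
  then have less: "y < Im z0" by (simp add: y_def)
  have y0: "0 < y" using mn by (simp add: y_def)
  define r where "r = exp (- (2 * pi * y))"
  have r: "0 < r" "r < 1" using y0 by (auto simp: r_def)
  \<comment> \<open>Maximality of \<open>z0\<close> bounds \<open>h\<close> by \<open>B\<close> on
    the circle of radius \<open>r\<close>, the image of the line at height \<open>y\<close>. As
    \<open>nome z0\<close> lies inside this circle, the bound carries over to it.\<close>
  define B where "B = norm (f z0) * Im z0 ^ n / (r ^ m * y ^ n)"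
  have "norm (h (nome z0)) \<le> B"
  proof (rule maximum_modulus_frontier [where S = "cball 0 r" and f = h])
    show "h holomorphic_on interior (cball 0 r)"
      using r by (auto intro!: holomorphic_on_subset [OF h])
    show "continuous_on (closure (cball 0 r)) h"
      using r by (auto intro!: holomorphic_on_imp_continuous_on holomorphic_on_subset [OF h])
    show "nome z0 \<in> cball 0 r"
      using less by (simp add: norm_nome r_def)
    fix q :: complex assume "q \<in> frontier (cball 0 r)"
    then have q: "norm q = r" using r by (simp add: frontier_cball)
    then have "q \<noteq> 0" using r by auto
    define z where "z = Ln q / (2 * of_real pi * \<i>)"
    have z: "z \<in> upper_half_plane" "nome z = q" "Im z = y"
      using nome_preimage [OF \<open>q \<noteq> 0\<close>] q r by (simp_all add: z_def r_def)
    have "norm (h q) * (r ^ m * y ^ n) = norm (f z) * Im z ^ n"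
      using z q by (simp add: f norm_mult norm_power)
    also have "\<dots> \<le> norm (f z0) * Im z0 ^ n" by (rule max [OF z(1)])
    finally show "norm (h q) \<le> B"
      using r y0 by (simp add: B_def field_simps)
  qed auto
  also have "B = norm (h (nome z0)) * (Im z0 ^ n * exp (- (2 * pi * m * Im z0))) / (r ^ m * y ^ n)"
    using z0 by (simp add: B_def f norm_mult norm_power norm_nome exp_of_nat_mult [symmetric] mult_ac)
  also have "r ^ m * y ^ n = y ^ n * exp (- (2 * pi * m * y))"
    by (simp add: r_def exp_of_nat_mult [symmetric] mult_ac)
  finally have *: "norm (h (nome z0)) * (y ^ n * exp (- (2 * pi * m * y)))
      \<le> norm (h (nome z0)) * (Im z0 ^ n * exp (- (2 * pi * m * Im z0)))"
    using y0 by (simp add: field_simps)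
  have "h (nome z0) \<noteq> 0" using z0 f by auto
  then have "y ^ n * exp (- (2 * pi * m * y)) \<le> Im z0 ^ n * exp (- (2 * pi * m * Im z0))"
    using * by simp
  with power_times_exp_decreasing [of n "2 * pi * m" y "Im z0"] mn less show False
    by (simp add: y_def)
qed

text \<open>\<open>norm (f z) * Im z ^ n\<close> is invariant under inversion and translation, and
  it decays at large height because \<open>m\<close> is positive. So its supremum over the
  half-plane is that over a compact box.\<close>

lemma maximum_attained:
  fixes m n :: nat
  assumes a: "has_q_expansion f a" and inv: "\<And>z. z \<in> upper_half_plane \<Longrightarrow> f (- 1 / z) = z ^ (2 * n) * f z"
    and mn: "0 < m" "0 < n" and am: "\<And>j. j < m \<Longrightarrow> a j = 0"
    and nz: "z1 \<in> upper_half_plane" "f z1 \<noteq> 0"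
  obtains z0 where "z0 \<in> upper_half_plane" "\<bar>Re z0\<bar> \<le> 1/2" "1 \<le> norm z0" "f z0 \<noteq> 0"
    "\<And>z. z \<in> upper_half_plane \<Longrightarrow> norm (f z) * Im z ^ n \<le> norm (f z0) * Im z0 ^ n"
    "Im z0 \<le> n / (2 * pi * m)"
proof -
  define G where "G z = norm (f z) * Im z ^ n" for z
  define h where "h = (\<lambda>q. \<Sum>i. a (i + m) * q ^ i)"
  have hs: "(\<lambda>i. a (i + m) * q ^ i) sums h q" if "norm q < 1" for q
  proof -
    have "summable (\<lambda>i. a (i + m) * q ^ i)"
    proof (cases "q = 0")
      case False
      have "summable (\<lambda>i. a (i + m) * q ^ (i + m))"
        using q_expansion_sums [OF a that]
        by (intro summable_ignore_initial_segment) (rule sums_summable)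
      then have "summable (\<lambda>i. (a (i + m) * q ^ (i + m)) * inverse (q ^ m))"
        by (rule summable_mult2)
      then show ?thesis using False by (simp add: power_add mult.assoc)
    next
      case True
      then show ?thesis using powser_sums_zero by (auto intro: sums_summable)
    qed
    then show ?thesis unfolding h_def by (rule summable_sums)
  qed
  have holh: "h holomorphic_on ball 0 1"
    by (rule power_series_holomorphic [where a = "\<lambda>i. a (i + m)"]) (use hs in simp)
  have fh: "f z = nome z ^ m * h (nome z)" if "z \<in> upper_half_plane" for z
  proof -
    have "(\<lambda>i. a (i + m) * nome z ^ (i + m)) sums (f z - (\<Sum>i<m. a i * nome z ^ i))"
      using a that by (intro sums_split_initial_segment) (simp add: has_q_expansion_nome)
    then have "(\<lambda>i. a (i + m) * nome z ^ (i + m)) sums f z" by (simp add: am)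
    moreover have "(\<lambda>i. nome z ^ m * (a (i + m) * nome z ^ i)) sums (nome z ^ m * h (nome z))"
      using hs [OF norm_nome_less_1 [OF that]] by (rule sums_mult)
    ultimately show ?thesis
      by (auto simp: power_add mult_ac intro: sums_unique2)
  qed
  have G_inv: "G (- 1 / z) = G z" if "z \<in> upper_half_plane" for z
  proof -
    have "z \<noteq> 0" using that by (auto simp: upper_half_plane_def)
    then show ?thesis
      using that by (simp only: G_def inv Im_minus_inverse)
        (simp add: norm_mult norm_power power_divide power_mult [symmetric])
  qed
  have G_shift: "G (z + of_int j) = G z" if "z \<in> upper_half_plane" for z j
    using q_expansion_add_of_int [OF a that] by (simp add: G_def)
  \<comment> \<open>4/5 is a rational bound below \<open>sqrt 3 / 2\<close>, the least height in the
    fundamental domain; it keeps the box away from the real axis.\<close>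
  have low: "4/5 \<le> Im w" if "w \<in> upper_half_plane" "\<bar>Re w\<bar> \<le> 1/2" "1 \<le> norm w" for w
  proof -
    have "1 \<le> (norm w)\<^sup>2" using that(3) by (simp add: one_le_power)
    moreover have "(Re w)\<^sup>2 \<le> (1/2)\<^sup>2"
      using that(2) by (metis abs_le_square_iff abs_of_pos half_gt_zero_iff zero_less_one)
    ultimately have "(4/5)\<^sup>2 \<le> (Im w)\<^sup>2" unfolding cmod_power2 by (simp add: power2_eq_square)
    then show ?thesis using that(1) by (intro power2_le_imp_le [of "4/5"]) (auto simp: upper_half_plane_def)
  qed
  obtain w1 where w1: "w1 \<in> upper_half_plane" "G w1 = G z1" "\<bar>Re w1\<bar> \<le> 1/2" "1 \<le> norm w1"
    using fundamental_domain [OF nz(1), of "\<lambda>w. G w = G z1"] G_inv G_shift by metis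
  have Gpos: "0 < G z1" using nz by (simp add: G_def upper_half_plane_def)
  \<comment> \<open>The disc of radius \<open>exp (- pi)\<close> corresponds to heights at least
    1/2.\<close>
  define r where "r = exp (- pi)"
  have r: "0 < r" "r < 1" by (auto simp: r_def)
  have "compact (h ` cball 0 r)"
    using r by (intro compact_continuous_image holomorphic_on_imp_continuous_on)
      (auto intro: holomorphic_on_subset [OF holh])
  then obtain C where C: "\<And>q. q \<in> cball 0 r \<Longrightarrow> norm (h q) \<le> C"
    by (metis compact_imp_bounded bounded_iff imageI)
  have Gle: "G z \<le> C * (Im z ^ n * exp (- (2 * pi * m * Im z)))"
    if "z \<in> upper_half_plane" "1/2 \<le> Im z" for z
  proof -
    have "norm (h (nome z)) \<le> C"
      using that(2) by (intro C) (simp add: norm_nome r_def)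
    then have "norm (h (nome z)) * (Im z ^ n * exp (- (2 * pi * m * Im z)))
        \<le> C * (Im z ^ n * exp (- (2 * pi * m * Im z)))"
      using that by (intro mult_right_mono) auto
    then show ?thesis
      using that by (simp add: G_def fh norm_mult norm_power norm_nome exp_of_nat_mult [symmetric] mult_ac)
  qed
  have "((\<lambda>y::real. y ^ n / exp y) \<longlongrightarrow> 0) at_top"
    by (rule tendsto_power_div_exp_0)
  then have "((\<lambda>y::real. C * (y ^ n / exp y)) \<longlongrightarrow> 0) at_top"
    by (rule tendsto_mult_right_zero)
  then have "eventually (\<lambda>y. C * (y ^ n / exp y) < G z1) at_top"
    using Gpos by (rule order_tendstoD(2))
  then obtain Y where Y: "\<And>y. Y \<le> y \<Longrightarrow> C * (y ^ n / exp y) < G z1"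
    by (auto simp: eventually_at_top_linorder)
  have C0: "0 \<le> C" using order_trans [OF norm_ge_zero C [of 0]] r by simp
  have high: "G z < G z1" if z: "z \<in> upper_half_plane" "1 \<le> Im z" "Y \<le> Im z" for z
  proof -
    have "Im z * 1 \<le> Im z * (2 * pi * m)"
      using z mn pi_ge_two by (intro mult_left_mono) (auto intro!: order_trans [of 1 "2 * pi" "2 * pi * m"])
    then have "exp (- (2 * pi * m * Im z)) \<le> exp (- Im z)" by (simp add: mult_ac)
    then have "C * (Im z ^ n * exp (- (2 * pi * m * Im z))) \<le> C * (Im z ^ n * exp (- Im z))"
      using C0 z by (intro mult_left_mono) auto
    also have "\<dots> < G z1" using Y [OF z(3)] by (simp add: exp_minus divide_inverse)
    finally show ?thesis using Gle [of z] z by simp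
  qed
  \<comment> \<open>Including \<open>Im w1\<close> puts a point with the value \<open>G z1\<close>
    into the box; above \<open>T\<close> all values are smaller than that.\<close>
  define T where "T = max (max Y 1) (Im w1)"
  define K where "K = cbox (Complex (-1/2) (4/5)) (Complex (1/2) T)"
  have inK: "z \<in> K \<longleftrightarrow> \<bar>Re z\<bar> \<le> 1/2 \<and> 4/5 \<le> Im z \<and> Im z \<le> T" for z
    by (auto simp: K_def in_cbox_complex_iff)
  have KH: "K \<subseteq> upper_half_plane" by (auto simp: inK upper_half_plane_def)
  have "w1 \<in> K" using w1 low [of w1] by (simp add: inK T_def)
  moreover have "continuous_on K G"
    unfolding G_def using q_expansion_holomorphic [OF a]
    by (intro continuous_intros continuous_on_subset [OF _ KH] holomorphic_on_imp_continuous_on)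
  ultimately obtain z2 where z2: "z2 \<in> K" "\<And>z. z \<in> K \<Longrightarrow> G z \<le> G z2"
    using continuous_attains_sup [of K G] by (auto simp: K_def)
  have max: "G z \<le> G z2" if z: "z \<in> upper_half_plane" for z
  proof -
    obtain w where w: "w \<in> upper_half_plane" "G w = G z" "\<bar>Re w\<bar> \<le> 1/2" "1 \<le> norm w"
      using fundamental_domain [OF z, of "\<lambda>w. G w = G z"] G_inv G_shift by metis
    show ?thesis
    proof (cases "Im w \<le> T")
      case True
      then show ?thesis using z2(2) [of w] w low [of w] by (simp add: inK)
    next
      case False
      then have "G w < G z1" using w(1) by (intro high) (auto simp: T_def)
      also have "\<dots> \<le> G z2" using z2(2) [OF \<open>w1 \<in> K\<close>] w1(2) by simp
      finally show ?thesis using w by simp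
    qed
  qed
  \<comment> \<open>The box is larger than the fundamental domain, so the maximum point is moved
    once more to reach \<open>1 \<le> norm z0\<close>.\<close>
  obtain z0 where z0: "z0 \<in> upper_half_plane" "G z0 = G z2" "\<bar>Re z0\<bar> \<le> 1/2" "1 \<le> norm z0"
    using fundamental_domain [of z2 "\<lambda>w. G w = G z2"] z2(1) KH G_inv G_shift by (metis subsetD)
  have max0: "norm (f z) * Im z ^ n \<le> norm (f z0) * Im z0 ^ n" if "z \<in> upper_half_plane" for z
    using max [OF that] z0(2) by (simp add: G_def)
  have "0 < G z0" using Gpos max [OF nz(1)] z0(2) by simp
  then have fz0: "f z0 \<noteq> 0" by (auto simp: G_def)
  show thesis
    using that [OF z0(1,3,4) fz0 max0] maximum_height [OF holh fh mn z0(1) fz0 max0] by blast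
qed

text \<open>The maximum would lie at height at most 5 / (2 pi) < 5/6, but 25/36 + 1/4 < 1 puts every
  such point of the strip inside the unit disc.\<close>

lemma zero_of_small_weight:
  fixes m n :: nat
  assumes "has_q_expansion f a" "\<And>z. z \<in> upper_half_plane \<Longrightarrow> f (- 1 / z) = z ^ (2 * n) * f z"
    and "0 < m" "0 < n" "\<And>j. j < m \<Longrightarrow> a j = 0"
    and "n \<le> 5 * m" and "z \<in> upper_half_plane"
  shows "f z = 0"
proof (rule ccontr)
  assume "f z \<noteq> 0"
  with maximum_attained [OF assms(1-5,7)] obtain z0 where
    z0: "z0 \<in> upper_half_plane" "\<bar>Re z0\<bar> \<le> 1/2" "1 \<le> norm z0" "Im z0 \<le> n / (2 * pi * m)"
    by metis
  have "real n \<le> 5 * real m" using assms(6) by linarith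
  then have "real n / (2 * pi * m) \<le> 5 * m / (2 * pi * m)"
    by (intro divide_right_mono) auto
  also have "\<dots> = 5 / (2 * pi)" using assms(3) by simp
  also have "\<dots> \<le> 5 / (2 * 3)" using pi_gt3 by (intro divide_left_mono) auto
  finally have "Im z0 \<le> 5 / 6" using z0 by simp
  then have "(Im z0)\<^sup>2 \<le> (5/6)\<^sup>2" using z0(1) by (intro power_mono) (auto simp: upper_half_plane_def)
  moreover have "(Re z0)\<^sup>2 \<le> (1/2)\<^sup>2"
    using z0(2) by (metis abs_le_square_iff abs_of_pos half_gt_zero_iff zero_less_one)
  moreover have "1 \<le> (norm z0)\<^sup>2" using z0(3) by (simp add: one_le_power)
  ultimately show False unfolding cmod_power2 by (simp add: power2_eq_square)
qed

section \<open>Forced zeros near the maximum: weights 22 and 26\<close>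

text \<open>A Schwarz lemma of second order: the critical point at the centre doubles the exponent
  of \<open>norm w0\<close>.\<close>

lemma zero_distance_in_disc:
  assumes F: "F holomorphic_on ball 0 1" and F0: "F 0 = 1"
    and le: "\<And>w. norm w < 1 \<Longrightarrow> norm (F w) * (1 - (norm w)\<^sup>2) ^ n \<le> 1"
    and n: "0 < n" and w0: "norm w0 < 1" "F w0 = 0" and r: "0 < r" "r < 1"
  shows "r\<^sup>2 * (1 - r\<^sup>2) ^ n \<le> (norm w0)\<^sup>2"
proof (cases "norm w0 \<le> r")
  case False
  have "r\<^sup>2 * (1 - r\<^sup>2) ^ n \<le> r\<^sup>2 * 1"
    using r by (intro mult_left_mono power_le_one) (auto simp: power_le_one)
  also have "\<dots> \<le> (norm w0)\<^sup>2" using False r by (simp add: power_mono)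
  finally show ?thesis .
next
  case True
  define c where "c = deriv F 0"
  have dF: "(F has_field_derivative c) (at 0)"
    unfolding c_def using F by (intro holomorphic_derivI [of _ "ball 0 1"]) auto
  \<comment> \<open>Along the line \<open>t * cnj c\<close> the real part of \<open>F\<close> has
    slope \<open>norm c ^ 2\<close> at 0, while the weight has slope 0. Their product is maximal at
    \<open>t = 0\<close>.\<close>
  have "c = 0"
  proof (rule ccontr)
    assume c: "c \<noteq> 0"
    define \<psi> where "\<psi> t = Re (F (of_real t * cnj c)) * (1 - t\<^sup>2 * (norm c)\<^sup>2) ^ n" for t :: real
    have "((\<lambda>t. of_real t * cnj c) has_vector_derivative (1 * cnj c)) (at 0)"
      by (intro has_vector_derivative_mult_left has_vector_derivative_of_real derivative_eq_intros)
         auto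
    moreover have "(F has_field_derivative c) (at (of_real 0 * cnj c))" using dF by simp
    ultimately have "((F \<circ> (\<lambda>t. of_real t * cnj c)) has_vector_derivative (1 * cnj c * c)) (at 0)"
      by (rule field_vector_diff_chain_at)
    then have "((\<lambda>t. Re (F (of_real t * cnj c))) has_real_derivative Re (1 * cnj c * c)) (at 0)"
      unfolding o_def has_vector_derivative_complex_iff by simp
    moreover have "((\<lambda>t. (1 - t\<^sup>2 * (norm c)\<^sup>2) ^ n) has_real_derivative 0) (at 0)"
      by (auto intro!: derivative_eq_intros)
    ultimately have "(\<psi> has_real_derivative Re (1 * cnj c * c)) (at 0)"
      unfolding \<psi>_def by (rule DERIV_cong [OF DERIV_mult]) simp_all
    moreover have "\<forall>t. \<bar>0 - t\<bar> < 1 / norm c \<longrightarrow> \<psi> t \<le> \<psi> 0"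
    proof (intro allI impI)
      fix t :: real assume "\<bar>0 - t\<bar> < 1 / norm c"
      then have t: "norm (of_real t * cnj c) < 1" using c by (simp add: norm_mult field_simps)
      then have t2: "(norm (of_real t * cnj c))\<^sup>2 < 1" by (simp add: power_less_one_iff)
      have "\<psi> t \<le> norm (F (of_real t * cnj c)) * (1 - (norm (of_real t * cnj c))\<^sup>2) ^ n"
        using t2 unfolding \<psi>_def
        by (simp add: norm_mult power_mult_distrib mult_right_mono complex_Re_le_cmod)
      also have "\<dots> \<le> 1" by (rule le [OF t])
      finally show "\<psi> t \<le> \<psi> 0" by (simp add: \<psi>_def F0)
    qed
    ultimately have "Re (1 * cnj c * c) = 0"
      using c by (intro DERIV_local_max [of \<psi> _ 0 "1 / norm c"]) auto
    then show False using c by (simp add: complex_eq_iff)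
  qed
  have "(\<lambda>w. F w - 1) holomorphic_on ball 0 1" using F by (intro holomorphic_intros)
  then obtain h1 where h1: "h1 holomorphic_on ball 0 1" "\<And>w. norm w < 1 \<Longrightarrow> F w - 1 = w * h1 w"
      "deriv (\<lambda>w. F w - 1) 0 = h1 0"
    using Schwarz3 [of "\<lambda>w. F w - 1" 1] F0 by (metis diff_self)
  have "deriv (\<lambda>w. F w - 1) 0 = 0"
    using dF \<open>c = 0\<close> by (intro DERIV_imp_deriv) (auto intro!: derivative_eq_intros)
  then obtain h where h: "h holomorphic_on ball 0 1" "\<And>w. norm w < 1 \<Longrightarrow> h1 w = w * h w"
    using Schwarz3 [OF h1(1)] h1(3) by metis
  \<comment> \<open>The least value of the weight on the disc of radius \<open>r\<close>; scaling by
    \<open>A\<close> maps this disc into the closed unit disc.\<close>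
  define A where "A = (1 - r\<^sup>2) ^ n"
  have r2: "0 < r\<^sup>2" "r\<^sup>2 < 1" using r by (auto simp: power_less_one_iff)
  have A: "0 < A" "A < 1" using r2 n by (auto simp: A_def power_less_one_iff)
  have AF: "norm (A * F w) \<le> 1" if "norm w \<le> r" for w
  proof -
    have "A \<le> (1 - (norm w)\<^sup>2) ^ n"
      unfolding A_def using r2 that by (intro power_mono) (auto simp: power_mono)
    then have "A * norm (F w) \<le> (1 - (norm w)\<^sup>2) ^ n * norm (F w)" by (rule mult_right_mono) simp
    also have "\<dots> \<le> 1" using le [of w] that r by (simp add: mult.commute)
    finally show ?thesis using A by (simp add: norm_mult)
  qed
  have den: "1 - A * (A * F w) \<noteq> 0" if "norm w \<le> r" for w
  proof
    assume "1 - A * (A * F w) = 0"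
    then have "norm (A * (A * F w)) = 1" by simp
    moreover have "norm (A * (A * F w)) \<le> A * 1"
      using AF [OF that] A by (subst norm_mult) (simp add: mult_left_mono)
    ultimately show False using A by simp
  qed
  \<comment> \<open>\<open>w\<^sup>2 * K w\<close> is the Moebius transform of
    \<open>A * F w\<close> that sends \<open>A\<close>, the value at the centre, to 0. At
    \<open>w0\<close> it equals \<open>- A\<close>, so a bound for \<open>K\<close> bounds
    \<open>A\<close> by \<open>norm w0\<close>.\<close>
  define K where "K w = A * h w / (1 - A * (A * F w))" for w
  have sub: "cball 0 r \<subseteq> ball (0::complex) 1" using r by auto
  have K: "K holomorphic_on cball 0 r"
    unfolding K_def using den
    by (intro holomorphic_intros holomorphic_on_subset [OF h(1) sub] holomorphic_on_subset [OF F sub]) auto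
  have Keq: "w\<^sup>2 * K w = (A * F w - A) / (1 - A * (A * F w))" if "norm w \<le> r" for w
  proof -
    have "F w = 1 + w * (w * h w)" using h1(2) [of w] h(2) [of w] that r by (simp add: algebra_simps)
    then have "A * F w - A = w\<^sup>2 * (A * h w)" by (simp add: algebra_simps power2_eq_square)
    then show ?thesis by (simp add: K_def)
  qed
  have "norm (K w0) \<le> 1 / r\<^sup>2"
  proof (rule maximum_modulus_frontier [where S = "cball 0 r" and f = K])
    show "K holomorphic_on interior (cball 0 r)"
      using K by (rule holomorphic_on_subset) (rule interior_subset)
    show "continuous_on (closure (cball 0 r)) K"
      using K by (simp add: holomorphic_on_imp_continuous_on)
    show "w0 \<in> cball 0 r" using True by simp
    fix w :: complex assume "w \<in> frontier (cball 0 r)"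
    then have w: "norm w = r" using r by (simp add: frontier_cball)
    define x where "x = A * F w"
    have "(norm x)\<^sup>2 \<le> 1" using AF [of w] w by (simp add: x_def power_le_one)
    moreover have "A\<^sup>2 \<le> 1" using A by (simp add: power_le_one)
    \<comment> \<open>This is the identity behind the fact that the Moebius transform preserves the
      unit disc.\<close>
    ultimately have "0 \<le> (1 - (norm x)\<^sup>2) * (1 - A\<^sup>2)" by simp
    also have "\<dots> = (norm (1 - A * x))\<^sup>2 - (norm (x - A))\<^sup>2"
      unfolding cmod_power2 by (simp add: power2_eq_square algebra_simps)
    finally have "(norm (x - A))\<^sup>2 \<le> (norm (1 - A * x))\<^sup>2" by linarith
    then have "norm (x - A) \<le> norm (1 - A * x)"
      by (rule power2_le_imp_le) (rule norm_ge_zero)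
    then have "norm ((x - A) / (1 - A * x)) \<le> 1"
      using den [of w] w by (simp add: norm_divide x_def)
    then have "norm (w\<^sup>2 * K w) \<le> 1" using Keq [of w] w by (simp add: x_def)
    then show "norm (K w) \<le> 1 / r\<^sup>2" using r w by (simp add: norm_mult norm_power field_simps)
  qed auto
  then have "(norm w0)\<^sup>2 * norm (K w0) \<le> (norm w0)\<^sup>2 * (1 / r\<^sup>2)" by (rule mult_left_mono) simp
  moreover have "(norm w0)\<^sup>2 * norm (K w0) = A"
  proof -
    have "w0\<^sup>2 * K w0 = - A" using Keq [of w0] True w0 by simp
    then have "norm (w0\<^sup>2 * K w0) = A" using A by simp
    then show ?thesis by (simp add: norm_mult norm_power)
  qed
  ultimately show ?thesis using r2 by (simp add: A_def field_simps)
qed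

text \<open>The Cayley map \<open>c\<close> sends the disc to the half-plane and 0 to
  \<open>z0\<close>. Dividing by \<open>(1 - w) ^ (2 * n)\<close> turns the weight
  \<open>Im z ^ n\<close> into the weight of the disc lemma, and \<open>norm w0\<close> is the
  pseudohyperbolic distance of \<open>P\<close> and \<open>z0\<close>.\<close>

lemma zero_distance_from_maximum:
  assumes f: "f holomorphic_on upper_half_plane"
    and z0: "z0 \<in> upper_half_plane" "f z0 \<noteq> 0"
    and max: "\<And>z. z \<in> upper_half_plane \<Longrightarrow> norm (f z) * Im z ^ n \<le> norm (f z0) * Im z0 ^ n"
    and n: "0 < n" and P: "P \<in> upper_half_plane" "f P = 0" and r: "0 < r" "r < 1"
  shows "r\<^sup>2 * (1 - r\<^sup>2) ^ n * (norm (P - cnj z0))\<^sup>2 \<le> (norm (P - z0))\<^sup>2"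
proof -
  define c where "c w = (z0 - cnj z0 * w) / (1 - w)" for w
  have y0: "0 < Im z0" "0 < Im P" using z0 P by (auto simp: upper_half_plane_def)
  have w1: "1 - w \<noteq> 0" if "norm w < 1" for w :: complex using that by auto
  have Imc: "Im (c w) = Im z0 * ((1 - (norm w)\<^sup>2) / (norm (1 - w))\<^sup>2)" for w
  proof -
    have "Im (c w) = Im ((z0 - cnj z0 * w) * cnj (1 - w)) / (norm (1 - w))\<^sup>2"
      unfolding c_def by (simp add: complex_div_cnj [of _ "1 - w"] Im_divide_of_real del: of_real_power)
    also have "Im ((z0 - cnj z0 * w) * cnj (1 - w)) = Im z0 * (1 - (norm w)\<^sup>2)"
      unfolding cmod_power2 by (simp add: power2_eq_square algebra_simps)
    finally show ?thesis by simp
  qed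
  have c: "c w \<in> upper_half_plane" if "norm w < 1" for w
  proof -
    have "(norm w)\<^sup>2 < 1" using that by (simp add: power_less_one_iff)
    then show ?thesis using Imc [of w] y0 w1 [OF that] by (simp add: upper_half_plane_def)
  qed
  define F where "F w = f (c w) / ((1 - w) ^ (2 * n) * f z0)" for w
  define w0 where "w0 = (P - z0) / (P - cnj z0)"
  have PD: "P - cnj z0 \<noteq> 0"
    using y0 by (metis add_pos_pos cnj.simps(2) diff_eq_diff_eq diff_minus_eq_add eq_iff_diff_eq_0 minus_complex.simps(2) not_less_iff_gr_or_eq zero_complex.simps(2))
  have "(norm (P - z0))\<^sup>2 < (norm (P - cnj z0))\<^sup>2"
    using y0 unfolding cmod_power2 by (simp add: power2_eq_square algebra_simps)
  then have "norm (P - z0) < norm (P - cnj z0)" by (rule power2_less_imp_less) simp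
  then have w0: "norm w0 < 1" using PD by (simp add: w0_def norm_divide)
  have cw0: "c w0 = P"
  proof -
    have "1 - w0 = (z0 - cnj z0) / (P - cnj z0)" using PD by (simp add: w0_def field_simps)
    moreover have "z0 - cnj z0 * w0 = P * (z0 - cnj z0) / (P - cnj z0)"
      using PD by (simp add: w0_def field_simps)
    moreover have "z0 - cnj z0 \<noteq> 0" using y0 by (auto simp: complex_eq_iff)
    ultimately show ?thesis using PD by (simp add: c_def)
  qed
  have holF: "F holomorphic_on ball 0 1"
  proof -
    have "c holomorphic_on ball 0 1"
      unfolding c_def using w1 by (intro holomorphic_intros) auto
    then have "(f \<circ> c) holomorphic_on ball 0 1"
      by (rule holomorphic_on_compose_gen [OF _ f]) (use c in auto)
    then have "(\<lambda>w. f (c w)) holomorphic_on ball 0 1" by (simp add: o_def)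
    then show ?thesis
      unfolding F_def using w1 z0(2) by (intro holomorphic_intros) auto
  qed
  have le: "norm (F w) * (1 - (norm w)\<^sup>2) ^ n \<le> 1" if "norm w < 1" for w
  proof -
    have "norm (F w) * (1 - (norm w)\<^sup>2) ^ n * (norm (f z0) * Im z0 ^ n) =
        norm (f (c w)) * (Im z0 * ((1 - (norm w)\<^sup>2) / (norm (1 - w))\<^sup>2)) ^ n"
      using z0(2) w1 [OF that]
      by (simp add: F_def norm_divide norm_mult norm_power power_mult power_mult_distrib power_divide)
    also have "\<dots> \<le> norm (f z0) * Im z0 ^ n" unfolding Imc [symmetric] by (rule max [OF c [OF that]])
    finally show ?thesis using z0(2) y0 by simp
  qed
  have "r\<^sup>2 * (1 - r\<^sup>2) ^ n \<le> (norm w0)\<^sup>2"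
    by (rule zero_distance_in_disc [OF holF _ le n w0 _ r])
       (use z0(2) P(2) cw0 in \<open>auto simp: F_def c_def\<close>)
  then show ?thesis
    using PD by (simp add: w0_def norm_divide power_divide field_simps)
qed

text \<open>The primitive sixth root of unity exp(pi i / 3). The points \<open>rho\<close> and
  \<open>rho - 1\<close> are the two corners of the fundamental domain.\<close>

definition rho :: complex where "rho = Complex (1/2) (sqrt 3 / 2)"

lemma rho_square: "rho\<^sup>2 = rho - 1"
  by (simp add: rho_def complex_eq_iff power2_eq_square)

lemma rho_cube: "rho ^ 3 = - 1"
proof -
  have "rho ^ 3 = rho * rho\<^sup>2" by (simp add: power3_eq_cube power2_eq_square)
  also have "\<dots> = rho\<^sup>2 - rho" by (simp add: rho_square algebra_simps power2_eq_square [symmetric])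
  also have "\<dots> = - 1" by (simp add: rho_square)
  finally show ?thesis .
qed

text \<open>In weights 22 and 26 the transformation rule forces zeros at the elliptic points; one of
  them lies too close to the maximum.\<close>

lemma zero_of_weight_22_26:
  assumes a: "has_q_expansion f a"
    and inv: "\<And>z. z \<in> upper_half_plane \<Longrightarrow> f (- 1 / z) = z ^ (2 * n) * f z"
    and am: "a 0 = 0" "a 1 = 0" and n: "n \<in> {11, 13}" and z: "z \<in> upper_half_plane"
  shows "f z = 0"
proof (rule ccontr)
  assume fz: "f z \<noteq> 0"
  have am': "a j = 0" if "j < 2" for j using am that by (auto simp: less_2_cases_iff)
  have n0: "0 < n" using n by auto
  obtain z0 where z0: "z0 \<in> upper_half_plane" "\<bar>Re z0\<bar> \<le> 1/2" "1 \<le> norm z0" "f z0 \<noteq> 0"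
    and max: "\<And>z. z \<in> upper_half_plane \<Longrightarrow> norm (f z) * Im z ^ n \<le> norm (f z0) * Im z0 ^ n"
    and height: "Im z0 \<le> n / (2 * pi * real 2)"
    using maximum_attained [OF a inv _ n0 am' z fz] by (metis pos2)
  define x where "x = \<bar>Re z0\<bar>"
  define y where "y = Im z0"
  define s where "s = sqrt 3 / 2"
  have s: "s\<^sup>2 = 3 / 4" "0 < s" by (auto simp: s_def power_divide)
  have s866: "866/1000 \<le> s" by (rule power2_le_imp_le) (use s in \<open>auto simp: power2_eq_square\<close>)
  have "real n / (2 * pi * real 2) \<le> 13 / (4 * pi)" using n by (auto simp: divide_right_mono)
  also have "\<dots> \<le> 13 / (4 * (314/100))"
    using pi_approx by (intro divide_left_mono) auto
  finally have y1: "y \<le> 1036/1000" using height by (simp add: y_def)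
  have y0: "0 < y" using z0(1) by (simp add: y_def upper_half_plane_def)
  have x: "0 \<le> x" "x \<le> 1/2" using z0(2) by (auto simp: x_def)
  have "1 \<le> (norm z0)\<^sup>2" using z0(3) by (simp add: one_le_power)
  then have xy: "1 \<le> x\<^sup>2 + y\<^sup>2" by (simp add: cmod_power2 x_def y_def)
  have far: "27/1000 * (norm (P - cnj z0))\<^sup>2 \<le> (norm (P - z0))\<^sup>2"
    if "P \<in> upper_half_plane" "f P = 0" for P
  proof -
    \<comment> \<open>The function \<open>x * (1 - x) ^ n\<close> peaks at 1 / (n + 1); 1/14 is
      optimal for n = 13, where the value only just exceeds 27/1000, and it also serves n =
      11.\<close>
    define r :: real where "r = sqrt (1/14)"
    have r: "0 < r" "r < 1" "r\<^sup>2 = 1/14" by (auto simp: r_def)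
    have "27/1000 \<le> (1/14) * (1 - 1/14 :: real) ^ n" using n by (auto simp: field_simps)
    then have "27/1000 * (norm (P - cnj z0))\<^sup>2 \<le> r\<^sup>2 * (1 - r\<^sup>2) ^ n * (norm (P - cnj z0))\<^sup>2"
      unfolding r(3) by (rule mult_right_mono) simp
    also have "\<dots> \<le> (norm (P - z0))\<^sup>2"
      by (rule zero_distance_from_maximum [OF q_expansion_holomorphic [OF a] z0(1,4) max n0 that r(1,2)])
    finally show ?thesis .
  qed
  show False
  \<comment> \<open>The threshold balances two estimates: near the imaginary axis the zero at
    \<open>\<i>\<close> gives 8/100 against 0.027 * 3.8, elsewhere the corner on the side of
    \<open>z0\<close> gives 78/1000 against 0.027 * 3.\<close>
  proof (cases "x \<le> 28/100")
    case True
    have "f (- 1 / \<i>) = \<i> ^ (2 * n) * f \<i>" by (rule inv) (simp add: upper_half_plane_def)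
    moreover have "\<i> ^ (2 * n) = - 1" using n by (auto simp: power_mult)
    ultimately have "f \<i> = 0" by (simp add: eq_neg_iff_add_eq_0)
    then have *: "27/1000 * (norm (\<i> - cnj z0))\<^sup>2 \<le> (norm (\<i> - z0))\<^sup>2"
      by (intro far) (simp_all add: upper_half_plane_def)
    have "x\<^sup>2 \<le> (28/100)\<^sup>2" using True x by (intro power_mono) auto
    then have "(96/100)\<^sup>2 \<le> y\<^sup>2" using xy by (simp add: power2_eq_square)
    then have y2: "96/100 \<le> y" using y0 by (intro power2_le_imp_le [of "96/100" y]) auto
    have "\<bar>1 - y\<bar> \<le> 4/100" using y1 y2 by linarith
    then have "(1 - y)\<^sup>2 \<le> (4/100)\<^sup>2" using abs_le_square_iff [of "1 - y" "4/100"] by simp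
    then have "(norm (\<i> - z0))\<^sup>2 \<le> 8/100"
      using \<open>x\<^sup>2 \<le> (28/100)\<^sup>2\<close> unfolding cmod_power2 by (simp add: x_def y_def power_divide)
    moreover have "(196/100)\<^sup>2 \<le> (1 + y)\<^sup>2" using y2 by (intro power_mono) auto
    then have "38/10 \<le> (norm (\<i> - cnj z0))\<^sup>2"
      unfolding cmod_power2 by (simp add: y_def power2_eq_square add_increasing)
    ultimately show False using * by simp
  next
    case False
    define P where "P = (if Re z0 \<ge> 0 then rho else rho + of_int (- 1))"
    have rho: "rho \<in> upper_half_plane" by (simp add: rho_def upper_half_plane_def)
    have rho0: "rho \<noteq> 0" by (simp add: rho_def complex_eq_iff)
    have "- 1 / rho = rho + of_int (- 1)"
      using rho_square rho0 rho_cube by (simp add: field_simps power2_eq_square)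
    then have "f (- 1 / rho) = f rho" using q_expansion_add_of_int [OF a rho] by metis
    then have "f rho = rho ^ (2 * n) * f rho" using inv [OF rho] by simp
    \<comment> \<open>\<open>rho\<close> has order 6, and neither 22 nor 26 is a multiple of
      6.\<close>
    moreover have "rho ^ (2 * n) \<noteq> 1"
    proof -
      have "rho ^ 22 = (rho ^ 3) ^ 7 * rho" "rho ^ 26 = (rho ^ 3) ^ 8 * rho\<^sup>2"
        by (simp_all flip: power_mult power_Suc2 power_add)
      then have "rho ^ 22 = - rho" "rho ^ 26 = rho - 1" by (simp_all add: rho_cube rho_square)
      moreover have "- rho \<noteq> 1" "rho - 1 \<noteq> 1" by (simp_all add: rho_def complex_eq_iff)
      ultimately show ?thesis using n by auto
    qed
    ultimately have "f rho = 0" by simp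
    then have "f P = 0" "P \<in> upper_half_plane"
      using q_expansion_add_of_int [OF a rho, of "- 1"] rho add_of_int_in_upper_half_plane [OF rho, of "- 1"]
      by (auto simp: P_def)
    then have *: "27/1000 * (norm (P - cnj z0))\<^sup>2 \<le> (norm (P - z0))\<^sup>2" by (intro far)
    have "s\<^sup>2 \<le> y\<^sup>2" using xy x power_mono [of x "1/2" 2] by (simp add: s power_divide)
    then have y2: "s \<le> y" using y0 by (intro power2_le_imp_le [of s y]) auto
    have ReP: "(Re P - Re z0)\<^sup>2 = (1/2 - x)\<^sup>2"
      by (auto simp: P_def rho_def x_def power2_eq_square algebra_simps)
    have ImP: "Im P = s" by (simp add: P_def rho_def s_def)
    have "(1/2 - x)\<^sup>2 \<le> (22/100)\<^sup>2" using False x by (intro power_mono) auto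
    moreover have "(y - s)\<^sup>2 \<le> (17/100)\<^sup>2" using y1 y2 s866 by (intro power_mono) auto
    moreover have "(norm (P - z0))\<^sup>2 = (1/2 - x)\<^sup>2 + (y - s)\<^sup>2"
      unfolding cmod_power2 by (simp add: ReP ImP y_def power2_commute)
    ultimately have "(norm (P - z0))\<^sup>2 \<le> 78/1000" by (simp add: power2_eq_square)
    moreover have "(2 * s)\<^sup>2 \<le> (s + y)\<^sup>2" using y2 s by (intro power_mono) auto
    then have "3 \<le> (norm (P - cnj z0))\<^sup>2"
      unfolding cmod_power2 by (simp add: ImP y_def power_mult_distrib s add_increasing)
    ultimately show False using * by simp
  qed
qed

section \<open>Hecke operators\<close>

lemma modular_form_inversion:
  assumes "f \<in> modular_forms k" "z \<in> upper_half_plane"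
  shows "f (- 1 / z) = z ^ k * f z"
proof -
  have "\<forall>a b c d :: int. a * d - b * c = 1 \<longrightarrow> (\<forall>z\<in>upper_half_plane.
      f ((of_int a * z + of_int b) / (of_int c * z + of_int d)) = (of_int c * z + of_int d) ^ k * f z)"
    using assms(1) by (simp add: modular_forms_def)
  \<comment> \<open>The instances follow the order of occurrence a, d, b, c: the matrix has a = d =
    0, b = -1 and c = 1.\<close>
  from this [rule_format, of 0 0 "- 1" 1 z] assms(2) show ?thesis by simp
qed

lemma modular_forms_mult:
  assumes "f \<in> modular_forms k" "g \<in> modular_forms l"
  shows "(\<lambda>z. f z * g z) \<in> modular_forms (k + l)"
  using assms unfolding modular_forms_def
  by (auto simp: power_add intro!: holomorphic_intros intro: has_q_expansion_mult)

lemma sum_roots_of_unity_power: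
  fixes p n :: nat
  assumes "0 < p"
  shows "(\<Sum>b<p. exp (2 * of_real pi * \<i> * (of_nat b / of_nat p)) ^ n)
      = (if p dvd n then of_nat p else (0 :: complex))"
proof -
  define w :: complex where "w = exp (2 * of_real pi * \<i> * (of_nat n / of_nat p))"
  have w: "exp (2 * of_real pi * \<i> * (of_nat b / of_nat p)) ^ n = w ^ b" for b
    by (simp add: w_def exp_of_nat_mult [symmetric] mult_ac)
  have wp: "w ^ p = 1"
    using assms exp_integer_2pi [of "of_nat n"] by (simp add: w_def exp_of_nat_mult [symmetric] mult_ac)
  have w1: "w = 1 \<longleftrightarrow> p dvd n"
  proof
    assume "w = 1"
    then obtain j :: int where "2 * pi * (n / p) = of_int (2 * j) * pi"
      unfolding w_def exp_eq_1 by auto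
    then have "real n = of_int j * real p" using assms by (simp add: field_simps)
    then have "int n = j * int p" by (metis of_int_eq_iff of_int_mult of_int_of_nat_eq)
    then show "p dvd n" by (metis dvd_triv_right int_dvd_int_iff)
  next
    assume "p dvd n"
    then obtain c where "n = p * c" by auto
    then show "w = 1"
      using assms exp_integer_2pi [of "of_nat c"] by (simp add: w_def mult_ac)
  qed
  show ?thesis
  proof (cases "p dvd n")
    case True
    then show ?thesis using w1 unfolding w by simp
  next
    case False
    then have "(\<Sum>b<p. w ^ b) = 0" using w1 wp by (simp add: geometric_sum)
    then show ?thesis using False unfolding w by simp
  qed
qed

text \<open>T_p, summed over the representatives (p 0; 0 1) and (1 b; 0 p) of the matrices of
  determinant p. This scaling makes \<open>a p\<close> the coefficient of T_p f at 1.\<close>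

definition hecke :: "nat \<Rightarrow> nat \<Rightarrow> (complex \<Rightarrow> complex) \<Rightarrow> complex \<Rightarrow> complex" where
  "hecke k p f z = of_nat p ^ (k - 1) * f (of_nat p * z) +
     (\<Sum>b<p. f ((z + of_nat b) / of_nat p)) / of_nat p"

definition hecke_coeff :: "nat \<Rightarrow> nat \<Rightarrow> (nat \<Rightarrow> complex) \<Rightarrow> nat \<Rightarrow> complex" where
  "hecke_coeff k p a n = a (p * n) + (if p dvd n then of_nat p ^ (k - 1) * a (n div p) else 0)"

lemma hecke_q_expansion:
  assumes a: "has_q_expansion f a" and p: "0 < p"
  shows "has_q_expansion (hecke k p f) (hecke_coeff k p a)"
  unfolding has_q_expansion_nome
proof
  fix z assume z: "z \<in> upper_half_plane"
  \<comment> \<open>In this p-th root of \<open>nome z\<close>, the sum over \<open>b\<close>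
    removes every exponent not divisible by \<open>p\<close>.\<close>
  define q where "q = nome (z / of_nat p)"
  have qp: "q ^ p = nome z"
    using p by (simp add: q_def nome_def exp_of_nat_mult [symmetric])
  have sub: "strict_mono ((*) p)" using p by (auto simp: strict_mono_def)
  have z1: "of_nat p * z \<in> upper_half_plane"
    and z2: "(z + of_nat b) / of_nat p \<in> upper_half_plane" for b
    using z p by (auto simp: upper_half_plane_def Im_divide_of_nat)
  have "(\<lambda>n. a n * nome (of_nat p * z) ^ n) sums f (of_nat p * z)"
    using a z1 by (simp add: has_q_expansion_nome)
  moreover have "nome (of_nat p * z) ^ n = nome z ^ (p * n)" for n
    by (simp add: nome_def power_mult) (simp add: exp_of_nat_mult [symmetric] mult_ac)
  ultimately have "(\<lambda>n. a n * nome z ^ (p * n)) sums f (of_nat p * z)" by simp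
  then have "(\<lambda>n. if p dvd n then a (n div p) * nome z ^ n else 0) sums f (of_nat p * z)"
    by (subst sums_mono_reindex [OF sub, symmetric]) (use p in auto)
  then have s1: "(\<lambda>n. of_nat p ^ (k - 1) * (if p dvd n then a (n div p) * nome z ^ n else 0))
      sums (of_nat p ^ (k - 1) * f (of_nat p * z))"
    by (rule sums_mult)
  have "(\<lambda>n. a n * nome ((z + of_nat b) / of_nat p) ^ n) sums f ((z + of_nat b) / of_nat p)" for b
    using a z2 by (simp add: has_q_expansion_nome)
  then have "(\<lambda>n. \<Sum>b<p. a n * nome ((z + of_nat b) / of_nat p) ^ n) sums
      (\<Sum>b<p. f ((z + of_nat b) / of_nat p))"
    by (intro sums_sum)
  moreover have "(\<Sum>b<p. a n * nome ((z + of_nat b) / of_nat p) ^ n) =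
      a n * q ^ n * (if p dvd n then of_nat p else 0)" for n
  proof -
    have "nome ((z + of_nat b) / of_nat p) = q * exp (2 * of_real pi * \<i> * (of_nat b / of_nat p))" for b
      by (simp add: q_def nome_def exp_add [symmetric] add_divide_distrib distrib_left)
    then have "(\<Sum>b<p. a n * nome ((z + of_nat b) / of_nat p) ^ n) =
        a n * q ^ n * (\<Sum>b<p. exp (2 * of_real pi * \<i> * (of_nat b / of_nat p)) ^ n)"
      by (simp add: power_mult_distrib sum_distrib_left mult_ac)
    then show ?thesis by (simp only: sum_roots_of_unity_power [OF p])
  qed
  ultimately have "(\<lambda>n. a n * q ^ n * (if p dvd n then of_nat p else 0)) sums
      (\<Sum>b<p. f ((z + of_nat b) / of_nat p))"
    by simp
  then have "(\<lambda>n. a (p * n) * q ^ (p * n) * of_nat p) sums (\<Sum>b<p. f ((z + of_nat b) / of_nat p))"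
    by (subst (asm) sums_mono_reindex [OF sub, symmetric]) (use p in auto)
  then have "(\<lambda>n. a (p * n) * q ^ (p * n) * of_nat p / of_nat p) sums
      ((\<Sum>b<p. f ((z + of_nat b) / of_nat p)) / of_nat p)"
    by (rule sums_divide)
  then have "(\<lambda>n. a (p * n) * nome z ^ n) sums ((\<Sum>b<p. f ((z + of_nat b) / of_nat p)) / of_nat p)"
    using p by (simp add: power_mult qp)
  from sums_add [OF s1 this] show "(\<lambda>n. hecke_coeff k p a n * nome z ^ n) sums hecke k p f z"
    unfolding hecke_def
    by (rule sums_cong [THEN iffD1, rotated]) (auto simp: hecke_coeff_def algebra_simps)
qed

text \<open>Inversion permutes the p + 1 terms. It exchanges \<open>f (p z)\<close> with the term
  \<open>b = 0\<close>; for other \<open>b\<close>, the point \<open>(- 1 / z + b) / p\<close> is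
  the image of \<open>(z + r b) / p\<close> under the matrix (b, -m; p, - r b), where
  \<open>b * r b + 1 = p * m\<close>. The map \<open>r\<close> is injective modulo \<open>p\<close>,
  hence a permutation.\<close>

lemma hecke_inversion:
  assumes f: "f \<in> modular_forms k" and k: "0 < k" and p: "prime p" and z: "z \<in> upper_half_plane"
  shows "hecke k p f (- 1 / z) = z ^ k * hecke k p f z"
proof -
  obtain a where a: "has_q_expansion f a" using f by (auto simp: modular_forms_def)
  have p0: "0 < p" using p by (rule prime_gt_0_nat)
  have z0: "z \<noteq> 0" using z by (auto simp: upper_half_plane_def)
  have pk: "of_nat p ^ k = (of_nat p :: complex) * of_nat p ^ (k - 1)"
    using k by (cases k) auto
  define g where "g b = f ((z + of_nat b) / of_nat p)" for b
  have zb: "(z + of_nat b) / of_nat p \<in> upper_half_plane" for b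
    using z p0 by (auto simp: upper_half_plane_def Im_divide_of_nat)
  have 1: "of_nat p ^ (k - 1) * f (of_nat p * (- 1 / z)) = z ^ k * (g 0 / of_nat p)"
  proof -
    have "f (of_nat p * (- 1 / z)) = f (- 1 / (z / of_nat p))" by simp
    also have "\<dots> = (z / of_nat p) ^ k * g 0"
      using modular_form_inversion [OF f zb [of 0]] by (simp add: g_def)
    finally show ?thesis using p0 by (simp add: power_divide pk)
  qed
  have 2: "f ((- 1 / z + of_nat 0) / of_nat p) / of_nat p = z ^ k * (of_nat p ^ (k - 1) * f (of_nat p * z))"
  proof -
    have pz: "of_nat p * z \<in> upper_half_plane" using z p0 by (simp add: upper_half_plane_def)
    have "f ((- 1 / z + of_nat 0) / of_nat p) = f (- 1 / (of_nat p * z))" by (simp add: field_simps)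
    also have "\<dots> = (of_nat p * z) ^ k * f (of_nat p * z)" by (rule modular_form_inversion [OF f pz])
    finally show ?thesis using p0 by (simp add: power_mult_distrib pk)
  qed
  have ex: "\<exists>c\<in>{1..<p}. p dvd b * c + 1" if "b \<in> {1..<p}" for b
  proof -
    have "\<not> p dvd b" using that by (auto dest: dvd_imp_le)
    then have "coprime b p" using p by (metis prime_imp_coprime coprime_commute)
    then obtain u v where uv: "u * int b + v * int p = 1"
      using bezout_int [of "int b" "int p"] by (auto simp: coprime_iff_gcd_eq_1)
    define c where "c = nat ((- u) mod int p)"
    have c: "int c = (- u) mod int p" "c < p" using p0 by (simp_all add: c_def nat_less_iff)
    have "int (b * c + 1) = int b * (- u - int p * ((- u) div int p)) + 1"
      by (simp add: c(1) minus_div_mult_eq_mod [symmetric] algebra_simps)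
    also have "\<dots> = int p * (v - int b * ((- u) div int p))"
      using uv by (simp add: algebra_simps)
    finally have d: "p dvd b * c + 1" by (metis dvd_triv_left int_dvd_int_iff)
    then have "c \<noteq> 0" using prime_gt_1_nat [OF p] by (intro notI) simp
    then show ?thesis using d c by (intro bexI [of _ c]) auto
  qed
  obtain r where r: "\<And>b. b \<in> {1..<p} \<Longrightarrow> r b \<in> {1..<p} \<and> p dvd b * r b + 1"
    using ex by metis
  have inj: "inj_on r {1..<p}"
  proof
    fix b c assume bc: "b \<in> {1..<p}" "c \<in> {1..<p}" "r b = r c"
    have "int p dvd int (b * r b + 1) - int (c * r b + 1)"
      using r [OF bc(1)] r [OF bc(2)] bc(3) by (intro dvd_diff) (simp_all only: int_dvd_int_iff)
    then have "int p dvd (int b - int c) * int (r b)" by (simp add: algebra_simps)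
    moreover have "\<not> int p dvd int (r b)"
      using r [OF bc(1)] by (auto dest: nat_dvd_not_less simp: int_dvd_int_iff)
    ultimately have "int p dvd int b - int c"
      using p by (simp add: prime_dvd_mult_iff)
    moreover have "\<bar>int b - int c\<bar> < int p" using bc by auto
    ultimately have "int b - int c = 0" using dvd_imp_le_int [of "int b - int c" "int p"] by linarith
    then show "b = c" by simp
  qed
  have "r ` {1..<p} = {1..<p}"
    using r inj by (intro card_subset_eq) (auto simp: card_image)
  then have bij: "bij_betw r {1..<p} {1..<p}" using inj by (simp add: bij_betw_def)
  have 3: "f ((- 1 / z + of_nat b) / of_nat p) = z ^ k * g (r b)" if b: "b \<in> {1..<p}" for b
  proof -
    obtain m where m: "b * r b + 1 = p * m" using r [OF b] by (auto elim: dvdE)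
    define w where "w = (z + of_nat (r b)) / of_nat p"
    have m': "of_nat b * of_nat (r b) = of_nat p * of_nat m - (1::complex)"
      using m by (metis add_diff_cancel_right' of_nat_1 of_nat_add of_nat_mult)
    have "int b * (- int (r b)) - (- int m) * int p = 1"
    proof -
      have "int (b * r b + 1) = int (p * m)" using m by simp
      then show ?thesis by (simp add: algebra_simps)
    qed
    then have *: "f ((of_int (int b) * w + of_int (- int m)) / (of_int (int p) * w + of_int (- int (r b)))) =
        (of_int (int p) * w + of_int (- int (r b))) ^ k * f w"
      using f zb [of "r b"] unfolding modular_forms_def w_def by blast
    have den: "of_int (int p) * w + of_int (- int (r b)) = z" using p0 by (simp add: w_def)
    have "of_int (int b) * w + of_int (- int m) = (of_nat b * z - 1) / of_nat p"
      using p0 m' by (simp add: w_def field_simps)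
    moreover have "(of_nat b * z - 1) / of_nat p / z = (- 1 / z + of_nat b) / of_nat p"
      using z0 p0 by (simp add: field_simps)
    ultimately have "(of_int (int b) * w + of_int (- int m)) / z = (- 1 / z + of_nat b) / of_nat p"
      by simp
    then show ?thesis using * unfolding den by (simp add: g_def w_def)
  qed
  have split: "(\<Sum>b<p. u b) = u 0 + (\<Sum>b\<in>{1..<p}. u b)" for u :: "nat \<Rightarrow> complex"
    using p0 by (metis lessThan_atLeast0 One_nat_def sum.atLeast_Suc_lessThan)
  have "(\<Sum>b\<in>{1..<p}. f ((- 1 / z + of_nat b) / of_nat p)) = (\<Sum>b\<in>{1..<p}. z ^ k * g (r b))"
    by (intro sum.cong refl 3)
  also have "\<dots> = (\<Sum>b\<in>{1..<p}. z ^ k * g b)"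
    by (rule sum.reindex_bij_betw [OF bij])
  also have "\<dots> = z ^ k * (\<Sum>b\<in>{1..<p}. g b)" by (simp add: sum_distrib_left)
  finally have 4: "(\<Sum>b\<in>{1..<p}. f ((- 1 / z + of_nat b) / of_nat p)) = z ^ k * (\<Sum>b\<in>{1..<p}. g b)" .
  have "hecke k p f (- 1 / z) = of_nat p ^ (k - 1) * f (of_nat p * (- 1 / z)) +
      (f ((- 1 / z + of_nat 0) / of_nat p) / of_nat p +
       (\<Sum>b\<in>{1..<p}. f ((- 1 / z + of_nat b) / of_nat p)) / of_nat p)"
    unfolding hecke_def split by (simp add: add_divide_distrib)
  also have "\<dots> = z ^ k * (of_nat p ^ (k - 1) * f (of_nat p * z) + (g 0 + (\<Sum>b\<in>{1..<p}. g b)) / of_nat p)"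
    unfolding 1 2 4 by (simp add: add_divide_distrib algebra_simps)
  also have "g 0 + (\<Sum>b\<in>{1..<p}. g b) = (\<Sum>b<p. g b)" by (rule split [symmetric])
  finally show ?thesis by (simp add: hecke_def g_def)
qed

section \<open>Eigenforms from the vanishing lemmas\<close>

text \<open>Since \<open>p\<close> divides 0, the constant term of T_p f is
  \<open>1 + p ^ (2 * n - 1)\<close> times \<open>a 0\<close>. Subtracting this multiple of
  \<open>f\<close> leaves a form vanishing at the cusp, which is zero in weight at most 10.\<close>

lemma eigenform_of_small_weight:
  assumes f: "f \<in> modular_forms (2 * n)" and a: "has_q_expansion f a"
    and n: "0 < n" "n \<le> 5" and p: "prime p"
  shows "hecke_coeff (2 * n) p a j = (1 + of_nat p ^ (2 * n - 1)) * a j"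
proof -
  define c :: complex where "c = 1 + of_nat p ^ (2 * n - 1)"
  define g where "g z = hecke (2 * n) p f z - c * f z" for z
  have g: "has_q_expansion g (\<lambda>j. hecke_coeff (2 * n) p a j - c * a j)"
    unfolding g_def
    by (intro has_q_expansion_diff has_q_expansion_cmult hecke_q_expansion a prime_gt_0_nat p)
  have "g z = 0" if "z \<in> upper_half_plane" for z
  proof (rule zero_of_small_weight [OF g _ zero_less_one n(1) _ _ that])
    show "g (- 1 / z) = z ^ (2 * n) * g z" if "z \<in> upper_half_plane" for z
      using hecke_inversion [OF f _ p that] modular_form_inversion [OF f that] n
      by (simp add: g_def algebra_simps)
    show "hecke_coeff (2 * n) p a j - c * a j = 0" if "j < 1" for j
      using that by (simp add: hecke_coeff_def c_def algebra_simps)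
  qed (use n in simp)
  then have "hecke_coeff (2 * n) p a j - c * a j = 0" by (rule q_expansion_of_zero [OF g])
  then show ?thesis by (simp add: c_def)
qed

text \<open>In these weights a form is thus determined by its coefficients at 0 and 1; this contains
  the uniqueness of Delta_k.\<close>

lemma vanishing_order_2:
  assumes a: "has_q_expansion f a"
    and inv: "\<And>z. z \<in> upper_half_plane \<Longrightarrow> f (- 1 / z) = z ^ k * f z"
    and am: "a 0 = 0" "a 1 = 0" and k: "k \<in> {12, 16, 18, 20, 22, 26}"
  shows "a j = 0"
proof (rule q_expansion_of_zero [OF a])
  fix z assume z: "z \<in> upper_half_plane"
  have "even k" using k by auto
  then obtain n where n: "k = 2 * n" by (rule evenE)
  note inv' = inv [unfolded n]
  show "f z = 0"
  proof (cases "n \<le> 10")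
    case True
    show ?thesis
      by (rule zero_of_small_weight [where m = 2, OF a inv' _ _ _ _ z])
         (use n k True am in \<open>auto simp: less_2_cases_iff\<close>)
  next
    case False
    then have n': "n \<in> {11, 13}" using n k by auto
    show ?thesis by (rule zero_of_weight_22_26 [OF a inv' am n' z])
  qed
qed

text \<open>As \<open>p\<close> does not divide 1, the coefficients of T_p f at 0 and 1 are 0 and
  \<open>a p\<close>, the same as those of \<open>a p * f\<close>.\<close>

lemma cusp_eigenform:
  assumes f: "f \<in> modular_forms k" and a: "has_q_expansion f a" and a01: "a 0 = 0" "a 1 = 1"
    and k: "k \<in> {12, 16, 18, 20, 22, 26}" and p: "prime p"
  shows "hecke_coeff k p a j = a p * a j"
proof -
  define g where "g z = hecke k p f z - a p * f z" for z
  have k0: "0 < k" using k by auto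
  have g: "has_q_expansion g (\<lambda>j. hecke_coeff k p a j - a p * a j)"
    unfolding g_def
    by (intro has_q_expansion_diff has_q_expansion_cmult hecke_q_expansion a prime_gt_0_nat p)
  have "hecke_coeff k p a j - a p * a j = 0"
  proof (rule vanishing_order_2 [OF g _ _ _ k])
    show "g (- 1 / z) = z ^ k * g z" if "z \<in> upper_half_plane" for z
      using hecke_inversion [OF f k0 p that] modular_form_inversion [OF f that]
      by (simp add: g_def algebra_simps)
  qed (use p a01 in \<open>auto simp: hecke_coeff_def\<close>)
  then show ?thesis by simp
qed

section \<open>Eisenstein series\<close>

lemma nome_eq_imp_eq:
  assumes per: "\<And>z. z \<in> upper_half_plane \<Longrightarrow> f (z + 1) = f z"
    and z: "z \<in> upper_half_plane" "w \<in> upper_half_plane" and eq: "nome z = nome w"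
  shows "f z = f w"
proof -
  have nat: "f (z + of_nat n) = f z" if "z \<in> upper_half_plane" for n z
  proof (induction n)
    case (Suc n)
    have "z + of_nat n \<in> upper_half_plane" using that by (simp add: upper_half_plane_def)
    then show ?case using per [of "z + of_nat n"] Suc by (simp add: add_ac)
  qed simp
  obtain m :: int where m: "2 * of_real pi * \<i> * z = 2 * of_real pi * \<i> * w + of_real (of_int (2 * m) * pi) * \<i>"
    using eq by (auto simp: nome_def exp_eq)
  have "2 * of_real pi * \<i> * z = 2 * of_real pi * \<i> * (w + of_int m)"
    unfolding m by (simp add: algebra_simps)
  then have zw: "z = w + of_int m" by simp
  show ?thesis
  proof (cases "0 \<le> m")
    case True
    then show ?thesis using nat [OF z(2), of "nat m"] by (simp add: zw)
  next
    case False
    then show ?thesis using nat [OF z(1), of "nat (- m)"] by (simp add: zw)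
  qed
qed

text \<open>By periodicity \<open>f\<close> descends to the punctured disc through any branch of the
  logarithm. Boundedness at large height makes the singularity at 0 removable, and the Taylor series
  of the extension is the expansion.\<close>

lemma q_expansion_exists:
  assumes f: "f holomorphic_on upper_half_plane"
    and per: "\<And>z. z \<in> upper_half_plane \<Longrightarrow> f (z + 1) = f z"
    and B: "\<And>z. z \<in> upper_half_plane \<Longrightarrow> 1 \<le> Im z \<Longrightarrow> norm (f z) \<le> B"
  shows "\<exists>a. has_q_expansion f a"
proof -
  define l where "l q = Ln q / (2 * of_real pi * \<i>)" for q
  \<comment> \<open>A second branch, cut along the positive axis: half a period changes the sign of
    the nome. The two branches together cover the punctured disc.\<close>
  define l' where "l' q = Ln (- q) / (2 * of_real pi * \<i>) + 1/2" for q
  have l: "l q \<in> upper_half_plane" "nome (l q) = q" "Im (l q) = - ln (norm q) / (2 * pi)"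
    if "q \<in> ball 0 1 - {0}" for q
    using nome_preimage [of q] that by (auto simp: l_def)
  have nome_half: "nome (z + 1/2) = - nome z" for z
    by (simp add: nome_def exp_add distrib_left)
  have l': "l' q \<in> upper_half_plane" "nome (l' q) = q" if "q \<in> ball 0 1 - {0}" for q
    using nome_preimage [of "- q"] that nome_half by (auto simp: l'_def upper_half_plane_def)
  have eq: "f (l q) = f (l' q)" if "q \<in> ball 0 1 - {0}" for q
    by (rule nome_eq_imp_eq [of f, OF per l(1) [OF that] l'(1) [OF that]])
       (simp_all add: l [OF that] l' [OF that])
  define U :: "complex set" where "U = ball 0 1 - \<real>\<^sub>\<le>\<^sub>0"
  define V :: "complex set" where "V = ball 0 1 - \<real>\<^sub>\<ge>\<^sub>0"
  have UV: "ball 0 1 - {0} = U \<union> V"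
    by (auto simp: U_def V_def nonneg_Reals_def nonpos_Reals_def)
  have "(f \<circ> l) holomorphic_on U"
  proof (rule holomorphic_on_compose_gen [OF _ f])
    show "l holomorphic_on U" unfolding l_def U_def by (intro holomorphic_intros) auto
    show "l ` U \<subseteq> upper_half_plane" using l(1) UV by blast
  qed
  moreover have "(f \<circ> l') holomorphic_on V"
  proof (rule holomorphic_on_compose_gen [OF _ f])
    have "- q \<notin> \<real>\<^sub>\<le>\<^sub>0" if "q \<in> V" for q
      using that by (auto simp: V_def uminus_nonpos_Reals_iff)
    then show "l' holomorphic_on V" unfolding l'_def by (intro holomorphic_intros) auto
    show "l' ` V \<subseteq> upper_half_plane" using l'(1) UV by blast
  qed
  then have "(f \<circ> l) holomorphic_on V"
    by (rule holomorphic_transform) (use eq UV in auto)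
  ultimately have "(f \<circ> l) holomorphic_on (U \<union> V)"
    by (rule holomorphic_on_Un)
       (auto simp: U_def V_def intro!: open_Diff closed_nonpos_Reals_complex closed_nonneg_Reals_complex)
  then have hol: "(f \<circ> l) holomorphic_on (ball 0 1 - {0})" by (simp only: UV)
  have "eventually (\<lambda>q. norm ((f \<circ> l) q) \<le> B) (at 0)"
    unfolding eventually_at
  proof (intro exI conjI ballI impI)
    show "0 < exp (- (2 * pi))" by simp
    fix q :: complex assume q: "q \<noteq> 0 \<and> dist q 0 < exp (- (2 * pi))"
    then have q1: "q \<in> ball 0 1 - {0}" using less_trans [of "norm q" "exp (- (2 * pi))" 1] by (simp add: dist_norm)
    have "ln (norm q) \<le> ln (exp (- (2 * pi)))"
      using q by (subst ln_le_cancel_iff) (auto simp: dist_norm)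
    then have "2 * pi * 1 \<le> 2 * pi * Im (l q)" using l(3) [OF q1] by simp
    then have "1 \<le> Im (l q)" by (subst (asm) mult_le_cancel_left_pos) auto
    then show "norm ((f \<circ> l) q) \<le> B" using B l(1) [OF q1] by simp
  qed
  then obtain g where g: "g holomorphic_on ball 0 1" "\<And>q. q \<in> ball 0 1 - {0} \<Longrightarrow> g q = (f \<circ> l) q"
    using holomorphic_on_extend_bounded [OF hol] by auto
  have "has_q_expansion f (\<lambda>n. (deriv ^^ n) g 0 / fact n)"
    unfolding has_q_expansion_nome
  proof
    fix z assume z: "z \<in> upper_half_plane"
    then have q: "nome z \<in> ball 0 1 - {0}" using norm_nome_less_1 by simp
    have "f (l (nome z)) = f z"
      by (rule nome_eq_imp_eq [of f, OF _ l(1) [OF q] z l(2) [OF q]]) (rule per)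
    then have "g (nome z) = f z" using g(2) [OF q] by simp
    then show "(\<lambda>n. (deriv ^^ n) g 0 / fact n * nome z ^ n) sums f z"
      using holomorphic_power_series [OF g(1), of "nome z"] q by simp
  qed
  then show ?thesis by blast
qed

section \<open>The lattice sums: convergence, modularity, constant term\<close>

definition lattice :: "(int \<times> int) set" where
  "lattice = UNIV - {(0, 0)}"

text \<open>The classical G of weight \<open>2 * l\<close>, not normalized. Unordered summation lets
  SL_2(Z) act by reindexing.\<close>

definition eisenstein :: "nat \<Rightarrow> complex \<Rightarrow> complex" where
  "eisenstein l z = (\<Sum>\<^sub>\<infinity>(m, n)\<in>lattice. inverse ((of_int m * z + of_int n) ^ (2 * l)))"

text \<open>The product form reduces summability to sums in one variable; up to a constant it
  dominates \<open>(m\<^sup>2 + n\<^sup>2) ^ l\<close> inverted, for \<open>l\<close> at least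
  2.\<close>

definition majorant :: "int \<times> int \<Rightarrow> real" where
  "majorant = (\<lambda>(m, n). inverse (1 + (of_int m)\<^sup>2) * inverse (1 + (of_int n)\<^sup>2))"

lemma majorant_summable: "majorant summable_on A"
proof -
  define w :: "int \<Rightarrow> real" where "w j = inverse (1 + (of_int j)\<^sup>2)" for j
  have "summable (\<lambda>j. w (int j))"
  proof (rule summable_comparison_test')
    show "summable (\<lambda>n. inverse (real n ^ 2))" by (rule inverse_power_summable) simp
    fix n :: nat assume "n \<ge> 1"
    then show "norm (w (int n)) \<le> inverse (real n ^ 2)"
      by (auto simp: w_def intro!: le_imp_inverse_le)
  qed
  then have s: "(\<lambda>j. w (int j)) summable_on UNIV"
    by (rule summable_nonneg_imp_summable_on) (simp add: w_def)
  have "w summable_on range int"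
    using s by (subst summable_on_reindex) (auto simp: o_def inj_on_def)
  moreover have "w summable_on range (\<lambda>j. - int j)"
    using s by (subst summable_on_reindex) (auto simp: o_def inj_on_def w_def)
  ultimately have "w summable_on (range int \<union> range (\<lambda>j. - int j))"
    by (rule summable_on_union)
  moreover have "range int \<union> range (\<lambda>j. - int j) = UNIV"
    by (auto simp: image_iff) (metis int_cases2)
  ultimately have w: "w summable_on UNIV" by simp
  have "majorant summable_on (Sigma UNIV (\<lambda>_. UNIV))"
  proof (rule summable_on_SigmaI)
    show "((\<lambda>n. majorant (m, n)) has_sum w m * infsum w UNIV) UNIV" for m
      using w unfolding majorant_def by (auto simp: w_def [symmetric] intro!: has_sum_cmult_right has_sum_infsum)
    show "(\<lambda>m. w m * infsum w UNIV) summable_on UNIV"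
      using w by (rule summable_on_cmult_left)
  qed (auto simp: majorant_def)
  then show ?thesis by (rule summable_on_subset) auto
qed

text \<open>The least eigenvalue of the form \<open>\<bar>m z + n\<bar>\<^sup>2\<close> is at least its determinant divided by its trace.\<close>

lemma norm_lattice_point_ge:
  fixes m n :: int
  shows "(Im z)\<^sup>2 / (1 + (norm z)\<^sup>2) * (of_int (m\<^sup>2 + n\<^sup>2)) \<le> (norm (of_int m * z + of_int n))\<^sup>2"
proof -
  define x y M N where "x = Re z" "y = Im z" "M = real_of_int m" "N = real_of_int n"
  note defs = this
  \<comment> \<open>Cayley-Hamilton for the Gram matrix Q of the form: trace Q times Q minus det Q
    times the identity is Q^2, and the right side is the squared length of Q (M, N).\<close>
  have "(1 + x\<^sup>2 + y\<^sup>2) * ((M * x + N)\<^sup>2 + (M * y)\<^sup>2) - y\<^sup>2 * (M\<^sup>2 + N\<^sup>2) =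
      ((x\<^sup>2 + y\<^sup>2) * M + x * N)\<^sup>2 + (x * M + N)\<^sup>2"
    by algebra
  then have "y\<^sup>2 * (M\<^sup>2 + N\<^sup>2) \<le> (1 + x\<^sup>2 + y\<^sup>2) * ((M * x + N)\<^sup>2 + (M * y)\<^sup>2)"
    by (metis diff_ge_0_iff_ge sum_power2_ge_zero)
  moreover have "0 < 1 + x\<^sup>2 + y\<^sup>2" by (simp add: add_pos_nonneg)
  ultimately have "y\<^sup>2 / (1 + x\<^sup>2 + y\<^sup>2) * (M\<^sup>2 + N\<^sup>2) \<le> (M * x + N)\<^sup>2 + (M * y)\<^sup>2"
    by (simp add: field_simps)
  then show ?thesis unfolding cmod_power2 by (simp add: defs add.assoc)
qed

text \<open>Keeping \<open>d\<close> separate from \<open>z\<close> makes the estimate uniform on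
  every set where the slope is at least \<open>d\<close>.\<close>

lemma eisenstein_term_bound:
  assumes d: "0 < d" "d \<le> (Im z)\<^sup>2 / (1 + (norm z)\<^sup>2)" and l: "2 \<le> l" and mn: "(m, n) \<in> lattice"
  shows "norm (inverse ((of_int m * z + of_int n) ^ (2 * l))) \<le> 4 / d ^ l * majorant (m, n)"
proof -
  define s where "s = real_of_int (m\<^sup>2 + n\<^sup>2)"
  define M N where "M = real_of_int m" "N = real_of_int n"
  have "m\<^sup>2 + n\<^sup>2 > 0" using mn by (auto simp: lattice_def sum_power2_gt_zero_iff)
  then have s1: "1 \<le> s" unfolding s_def by linarith
  have sMN: "s = M\<^sup>2 + N\<^sup>2" by (simp add: s_def M_N_def)
  have "(1 + M\<^sup>2) * (1 + N\<^sup>2) \<le> (1 + s) * (1 + s)"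
    by (intro mult_mono) (auto simp: sMN)
  also have "\<dots> \<le> (2 * s) * (2 * s)" using s1 by (intro mult_mono) auto
  also have "\<dots> = 4 * s\<^sup>2" by (simp add: power2_eq_square)
  also have "\<dots> \<le> 4 * s ^ l" using s1 l by (intro mult_left_mono power_increasing) auto
  finally have "d ^ l * ((1 + M\<^sup>2) * (1 + N\<^sup>2)) \<le> d ^ l * (4 * s ^ l)"
    using d by (intro mult_left_mono) auto
  also have "\<dots> = 4 * (d * s) ^ l" by (simp add: power_mult_distrib)
  also have "\<dots> \<le> 4 * ((norm (of_int m * z + of_int n))\<^sup>2) ^ l"
  proof (intro mult_left_mono power_mono)
    have "d * s \<le> (Im z)\<^sup>2 / (1 + (norm z)\<^sup>2) * s" using d s1 by (intro mult_right_mono) auto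
    also have "\<dots> \<le> (norm (of_int m * z + of_int n))\<^sup>2" unfolding s_def by (rule norm_lattice_point_ge)
    finally show "d * s \<le> (norm (of_int m * z + of_int n))\<^sup>2" .
  qed (use d s1 in auto)
  finally have *: "d ^ l * ((1 + M\<^sup>2) * (1 + N\<^sup>2)) \<le> 4 * norm ((of_int m * z + of_int n) ^ (2 * l))"
    by (simp add: norm_power power_mult)
  have pos: "0 < d ^ l * ((1 + M\<^sup>2) * (1 + N\<^sup>2))"
    using d by (intro mult_pos_pos zero_less_power add_pos_nonneg) auto
  then have "inverse (4 * norm ((of_int m * z + of_int n) ^ (2 * l))) \<le> inverse (d ^ l * ((1 + M\<^sup>2) * (1 + N\<^sup>2)))"
    using * by (intro le_imp_inverse_le)
  then have "4 * inverse (4 * norm ((of_int m * z + of_int n) ^ (2 * l))) \<le> 4 * inverse (d ^ l * ((1 + M\<^sup>2) * (1 + N\<^sup>2)))"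
    by (rule mult_left_mono) simp
  moreover have "4 * inverse (4 * norm ((of_int m * z + of_int n) ^ (2 * l))) =
      norm (inverse ((of_int m * z + of_int n) ^ (2 * l)))"
    by (subst norm_inverse, subst inverse_mult_distrib) simp
  moreover have "4 * inverse (d ^ l * ((1 + M\<^sup>2) * (1 + N\<^sup>2))) = 4 / d ^ l * majorant (m, n)"
    by (simp only: majorant_def M_N_def inverse_mult_distrib divide_inverse prod.case mult.assoc)
  ultimately show ?thesis by (simp only:)
qed

lemma eisenstein_slope_pos:
  assumes "z \<in> upper_half_plane"
  shows "0 < (Im z)\<^sup>2 / (1 + (norm z)\<^sup>2)"
  using assms by (intro divide_pos_pos add_pos_nonneg) (auto simp: upper_half_plane_def)

lemma eisenstein_abs_summable:
  assumes "z \<in> upper_half_plane" "2 \<le> l"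
  shows "(\<lambda>p. norm (case p of (m, n) \<Rightarrow> inverse ((of_int m * z + of_int n) ^ (2 * l)))) summable_on lattice"
proof (rule summable_on_comparison_test)
  define d where "d = (Im z)\<^sup>2 / (1 + (norm z)\<^sup>2)"
  show "(\<lambda>p. 4 / d ^ l * majorant p) summable_on lattice"
    by (intro summable_on_cmult_right majorant_summable)
  show "norm (case p of (m, n) \<Rightarrow> inverse ((of_int m * z + of_int n) ^ (2 * l))) \<le> 4 / d ^ l * majorant p"
    if "p \<in> lattice" for p
  proof (cases p)
    case (Pair m n)
    have "0 < d" "d \<le> (Im z)\<^sup>2 / (1 + (norm z)\<^sup>2)"
      unfolding d_def using eisenstein_slope_pos [OF assms(1)] by simp_all
    then show ?thesis using eisenstein_term_bound [of d z l m n] assms(2) that Pair by simp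
  qed
qed simp

lemma eisenstein_uniform_limit:
  assumes l: "2 \<le> l" and d: "0 < d" and Y: "\<And>z. z \<in> Y \<Longrightarrow> d \<le> (Im z)\<^sup>2 / (1 + (norm z)\<^sup>2)"
  shows "uniform_limit Y (\<lambda>X z. \<Sum>(m, n)\<in>X. inverse ((of_int m * z + of_int n) ^ (2 * l)))
      (eisenstein l) (finite_subsets_at_top lattice)"
proof -
  have "uniform_limit Y (\<lambda>X z. \<Sum>p\<in>X. case p of (m, n) \<Rightarrow> inverse ((of_int m * z + of_int n) ^ (2 * l)))
      (\<lambda>z. \<Sum>\<^sub>\<infinity>p\<in>lattice. case p of (m, n) \<Rightarrow> inverse ((of_int m * z + of_int n) ^ (2 * l)))
      (finite_subsets_at_top lattice)"
  proof (rule Weierstrass_m_test_general)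
    show "(\<lambda>p. 4 / d ^ l * majorant p) summable_on lattice"
      by (intro summable_on_cmult_right majorant_summable)
    show "norm (case p of (m, n) \<Rightarrow> inverse ((of_int m * z + of_int n) ^ (2 * l))) \<le> 4 / d ^ l * majorant p"
      if "p \<in> lattice" "z \<in> Y" for p z
      using eisenstein_term_bound [OF d Y [OF that(2)] l] that(1) by (cases p) auto
  qed
  then show ?thesis by (simp add: eisenstein_def [abs_def])
qed

lemma lattice_point_nonzero:
  assumes "z \<in> upper_half_plane" "(m, n) \<in> lattice"
  shows "of_int m * z + of_int n \<noteq> 0"
  using assms by (auto simp: lattice_def upper_half_plane_def complex_eq_iff)

text \<open>The slope is continuous and positive, so it has a positive minimum on each closed disc
  in the half-plane; there the finite sums converge uniformly.\<close>

lemma eisenstein_holomorphic: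
  assumes l: "2 \<le> l"
  shows "eisenstein l holomorphic_on upper_half_plane"
proof -
  have op: "open upper_half_plane"
    unfolding upper_half_plane_def by (rule open_halfspace_Im_gt)
  have "eisenstein l field_differentiable at z0" if z0: "z0 \<in> upper_half_plane" for z0
  proof -
    obtain r where r: "0 < r" "cball z0 r \<subseteq> upper_half_plane"
      using op z0 open_contains_cball by blast
    have cont: "continuous_on (cball z0 r) (\<lambda>z. (Im z)\<^sup>2 / (1 + (norm z)\<^sup>2))"
      by (intro continuous_intros) (metis add_pos_nonneg less_irrefl zero_le_power2 zero_less_one)
    have "cball z0 r \<noteq> {}" using r(1) by simp
    then obtain z1 where z1: "z1 \<in> cball z0 r"
        "\<And>z. z \<in> cball z0 r \<Longrightarrow> (Im z1)\<^sup>2 / (1 + (norm z1)\<^sup>2) \<le> (Im z)\<^sup>2 / (1 + (norm z)\<^sup>2)"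
      using continuous_attains_inf [OF compact_cball _ cont] by blast
    have ulim: "uniform_limit (cball z0 r) (\<lambda>X z. \<Sum>(m, n)\<in>X. inverse ((of_int m * z + of_int n) ^ (2 * l)))
        (eisenstein l) (finite_subsets_at_top lattice)"
      using z1 r(2) by (intro eisenstein_uniform_limit [OF l eisenstein_slope_pos [of z1]]) auto
    have ev: "\<forall>\<^sub>F X in finite_subsets_at_top lattice.
        continuous_on (cball z0 r) (\<lambda>z. \<Sum>(m, n)\<in>X. inverse ((of_int m * z + of_int n) ^ (2 * l))) \<and>
        (\<lambda>z. \<Sum>(m, n)\<in>X. inverse ((of_int m * z + of_int n) ^ (2 * l))) holomorphic_on ball z0 r"
    proof (rule eventually_finite_subsets_at_top_weakI)
      fix X assume X: "finite X" "X \<subseteq> lattice"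
      have "(\<lambda>z. \<Sum>(m, n)\<in>X. inverse ((of_int m * z + of_int n) ^ (2 * l))) holomorphic_on cball z0 r"
        unfolding case_prod_unfold
      proof (intro holomorphic_intros)
        fix p z assume "p \<in> X" "z \<in> cball z0 r"
        then have "z \<in> upper_half_plane" "(fst p, snd p) \<in> lattice" using X r(2) by auto
        then show "(of_int (fst p) * z + of_int (snd p)) ^ (2 * l) \<noteq> 0"
          using lattice_point_nonzero by simp
      qed
      then show "continuous_on (cball z0 r) (\<lambda>z. \<Sum>(m, n)\<in>X. inverse ((of_int m * z + of_int n) ^ (2 * l))) \<and>
        (\<lambda>z. \<Sum>(m, n)\<in>X. inverse ((of_int m * z + of_int n) ^ (2 * l))) holomorphic_on ball z0 r"
        using holomorphic_on_imp_continuous_on holomorphic_on_subset ball_subset_cball by blast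
    qed
    have "eisenstein l holomorphic_on ball z0 r"
      by (rule holomorphic_uniform_limit [OF ev ulim]) simp_all
    then show ?thesis
      using r(1) by (auto intro: holomorphic_on_imp_differentiable_at)
  qed
  then show ?thesis
    by (auto simp: holomorphic_on_def intro: field_differentiable_at_within)
qed

text \<open>Multiplying the row (m, n) by the matrix permutes the nonzero pairs. Here
  \<open>\<phi>\<close> is this action and \<open>\<psi>\<close> that of the inverse matrix.\<close>

lemma eisenstein_modular:
  assumes det: "a * d - b * c = (1 :: int)" and z: "z \<in> upper_half_plane"
  shows "eisenstein l ((of_int a * z + of_int b) / (of_int c * z + of_int d)) =
      (of_int c * z + of_int d) ^ (2 * l) * eisenstein l z"
proof -
  define w where "w = of_int c * z + of_int d"
  define g :: "int \<times> int \<Rightarrow> complex" where "g = (\<lambda>(m, n). inverse ((of_int m * z + of_int n) ^ (2 * l)))"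
  have "(c, d) \<in> lattice" using det by (auto simp: lattice_def)
  then have w0: "w \<noteq> 0" unfolding w_def by (rule lattice_point_nonzero [OF z])
  define \<phi> where "\<phi> = (\<lambda>(m :: int, n :: int). (m * a + n * c, m * b + n * d))"
  define \<psi> where "\<psi> = (\<lambda>(m :: int, n :: int). (m * d - n * c, n * a - m * b))"
  have inv1: "\<psi> (\<phi> p) = p" for p
  proof (cases p)
    case (Pair m n)
    have "\<psi> (\<phi> (m, n)) = (m * (a * d - b * c), n * (a * d - b * c))"
      by (simp add: \<phi>_def \<psi>_def algebra_simps)
    then show ?thesis by (simp add: det Pair)
  qed
  have inv2: "\<phi> (\<psi> p) = p" for p
  proof (cases p)
    case (Pair m n)
    have "\<phi> (\<psi> (m, n)) = (m * (a * d - b * c), n * (a * d - b * c))"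
      by (simp add: \<phi>_def \<psi>_def algebra_simps)
    then show ?thesis by (simp add: det Pair)
  qed
  have zero: "\<phi> (0, 0) = (0, 0)" "\<psi> (0, 0) = (0, 0)" by (auto simp: \<phi>_def \<psi>_def)
  have "\<phi> p \<in> lattice" "\<psi> p \<in> lattice" if "p \<in> lattice" for p
  proof -
    have "p \<noteq> (0, 0)" using that by (simp add: lattice_def)
    then have "\<phi> p \<noteq> (0, 0)" "\<psi> p \<noteq> (0, 0)" using inv1 inv2 zero by metis+
    then show "\<phi> p \<in> lattice" "\<psi> p \<in> lattice" by (simp_all add: lattice_def)
  qed
  then have bij: "bij_betw \<phi> lattice lattice"
    by (intro bij_betw_byWitness [of _ \<psi>]) (simp_all add: inv1 inv2 image_subset_iff)
  have summand: "inverse ((of_int m * ((of_int a * z + of_int b) / w) + of_int n) ^ (2 * l)) =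
      w ^ (2 * l) * g (\<phi> (m, n))" for m n
  proof -
    have "of_int m * ((of_int a * z + of_int b) / w) + of_int n =
        (of_int (m * a + n * c) * z + of_int (m * b + n * d)) / w"
      using w0 by (simp add: field_simps) (simp add: w_def algebra_simps)
    then show ?thesis
      by (simp add: g_def \<phi>_def power_divide inverse_eq_divide)
  qed
  have "eisenstein l ((of_int a * z + of_int b) / w) = (\<Sum>\<^sub>\<infinity>p\<in>lattice. w ^ (2 * l) * g (\<phi> p))"
    unfolding eisenstein_def using summand by (intro infsum_cong) auto
  also have "\<dots> = w ^ (2 * l) * (\<Sum>\<^sub>\<infinity>p\<in>lattice. g (\<phi> p))"
    by (rule infsum_cmult_right')
  also have "(\<Sum>\<^sub>\<infinity>p\<in>lattice. g (\<phi> p)) = (\<Sum>\<^sub>\<infinity>p\<in>lattice. g p)"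
    by (rule infsum_reindex_bij_betw [OF bij])
  also have "\<dots> = eisenstein l z" by (simp add: eisenstein_def g_def)
  finally show ?thesis by (simp add: w_def)
qed

text \<open>The slope degenerates as the real part grows, so \<open>z\<close> is first moved into
  the strip; there 1 + 1/4 + y^2 is at most 3 y^2 for y at least 1, hence the constant 1/3.\<close>

lemma eisenstein_bounded:
  assumes l: "2 \<le> l"
  obtains B where "\<And>z. 1 \<le> Im z \<Longrightarrow> norm (eisenstein l z) \<le> B"
proof
  fix z assume Imz: "1 \<le> Im z"
  obtain j :: int where j: "\<bar>Re (z + of_int j)\<bar> \<le> 1/2" by (rule translate_to_strip)
  define w where "w = z + of_int j"
  have z: "z \<in> upper_half_plane" "w \<in> upper_half_plane" using Imz by (auto simp: upper_half_plane_def w_def)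
  have "eisenstein l z = eisenstein l w"
    using eisenstein_modular [of 1 1 j 0 z l] z(1) by (simp add: w_def)
  have "(Re w)\<^sup>2 \<le> (1/2)\<^sup>2" using j
    by (metis abs_le_square_iff abs_of_pos half_gt_zero_iff zero_less_one w_def)
  moreover have "1 \<le> (Im w)\<^sup>2" using Imz by (simp add: w_def one_le_power)
  ultimately have "1 + (norm w)\<^sup>2 \<le> 3 * (Im w)\<^sup>2"
    unfolding cmod_power2 by (simp add: power2_eq_square)
  moreover have "0 < 1 + (norm w)\<^sup>2" by (simp add: add_pos_nonneg)
  ultimately have d: "1/3 \<le> (Im w)\<^sup>2 / (1 + (norm w)\<^sup>2)" by (simp add: field_simps)
  have "norm (eisenstein l w) \<le> (\<Sum>\<^sub>\<infinity>p\<in>lattice. 4 / (1/3) ^ l * majorant p)"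
    unfolding eisenstein_def
  proof (rule norm_infsum_le)
    show "((\<lambda>(m, n). inverse ((of_int m * w + of_int n) ^ (2 * l))) has_sum
        (\<Sum>\<^sub>\<infinity>(m, n)\<in>lattice. inverse ((of_int m * w + of_int n) ^ (2 * l)))) lattice"
      by (rule has_sum_infsum [OF abs_summable_summable [OF eisenstein_abs_summable [OF z(2) l]]])
    show "((\<lambda>p. 4 / (1/3) ^ l * majorant p) has_sum (\<Sum>\<^sub>\<infinity>p\<in>lattice. 4 / (1/3) ^ l * majorant p)) lattice"
      by (rule has_sum_infsum [OF summable_on_cmult_right [OF majorant_summable]])
    show "norm (case p of (m, n) \<Rightarrow> inverse ((of_int m * w + of_int n) ^ (2 * l))) \<le> 4 / (1/3) ^ l * majorant p"
      if "p \<in> lattice" for p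
      using eisenstein_term_bound [OF _ d l, of "fst p" "snd p"] that by (simp only: case_prod_unfold prod.collapse)
  qed
  then show "norm (eisenstein l z) \<le> (\<Sum>\<^sub>\<infinity>p\<in>lattice. 4 / (1/3) ^ l * majorant p)"
    by (simp only: \<open>eisenstein l z = eisenstein l w\<close>)
qed

lemma eisenstein_modular_form:
  assumes l: "2 \<le> l"
  shows "eisenstein l \<in> modular_forms (2 * l)"
proof -
  obtain B where B: "\<And>z. 1 \<le> Im z \<Longrightarrow> norm (eisenstein l z) \<le> B"
    using eisenstein_bounded [OF l] by blast
  have "eisenstein l (z + 1) = eisenstein l z" if "z \<in> upper_half_plane" for z
    using eisenstein_modular [of 1 1 1 0 z l] that by simp
  then have "\<exists>a. has_q_expansion (eisenstein l) a"
    using q_expansion_exists [OF eisenstein_holomorphic [OF l]] B by blast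
  then show ?thesis
    unfolding modular_forms_def using eisenstein_holomorphic [OF l] eisenstein_modular by blast
qed

text \<open>As \<open>z\<close> tends to \<open>\<i>\<infinity>\<close> only the terms with \<open>m = 0\<close> survive, and those are positive.\<close>

lemma eisenstein_constant_term:
  assumes l: "2 \<le> l" and a: "has_q_expansion (eisenstein l) a"
  shows "a 0 \<noteq> 0"
proof
  assume a0: "a 0 = 0"
  define t where "t y = (\<lambda>(m :: int, n :: int). inverse ((of_int m * (of_real y * \<i>) + of_int n) ^ (2 * l)))" for y :: real
  define Y where "Y = (\<lambda>y. of_real y * \<i>) ` {1..}"
  have "uniform_limit Y (\<lambda>X z. \<Sum>(m, n)\<in>X. inverse ((of_int m * z + of_int n) ^ (2 * l)))
      (eisenstein l) (finite_subsets_at_top lattice)"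
  proof (rule eisenstein_uniform_limit [OF l, of "1/2"])
    fix z assume "z \<in> Y"
    then obtain y :: real where y: "1 \<le> y" "z = of_real y * \<i>" by (auto simp: Y_def)
    have "1 \<le> y\<^sup>2" using y by (simp add: one_le_power)
    then have "1 + y\<^sup>2 \<le> 2 * y\<^sup>2" "0 < 1 + y\<^sup>2" by simp_all
    then show "1/2 \<le> (Im z)\<^sup>2 / (1 + (norm z)\<^sup>2)"
      using y by (simp add: norm_mult field_simps)
  qed simp
  then have "\<forall>\<^sub>F X in finite_subsets_at_top lattice. \<forall>z\<in>Y.
      dist (\<Sum>(m, n)\<in>X. inverse ((of_int m * z + of_int n) ^ (2 * l))) (eisenstein l z) < 1"
    by (rule uniform_limitD) simp
  then have "\<exists>X0. finite X0 \<and> X0 \<subseteq> lattice \<and> (\<forall>X. finite X \<and> X0 \<subseteq> X \<and> X \<subseteq> lattice \<longrightarrow> (\<forall>z\<in>Y.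
      dist (\<Sum>(m, n)\<in>X. inverse ((of_int m * z + of_int n) ^ (2 * l))) (eisenstein l z) < 1))"
    by (simp only: eventually_finite_subsets_at_top)
  then obtain X0 where X0: "finite X0" "X0 \<subseteq> lattice" and near:
    "\<forall>X. finite X \<and> X0 \<subseteq> X \<and> X \<subseteq> lattice \<longrightarrow> (\<forall>z\<in>Y.
      dist (\<Sum>(m, n)\<in>X. inverse ((of_int m * z + of_int n) ^ (2 * l))) (eisenstein l z) < 1)"
    by (elim exE conjE)
  \<comment> \<open>The adjoined pairs contribute 2 to the limit of the finite sum, whereas
    \<open>a 0 = 0\<close> and the approximation error allow at most 1.\<close>
  define X where "X = X0 \<union> {(0, 1), (0, - 1)}"
  have X: "finite X" "X0 \<subseteq> X" "X \<subseteq> lattice" using X0 by (auto simp: X_def lattice_def)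
  have close: "norm ((\<Sum>p\<in>X. t y p) - eisenstein l (of_real y * \<i>)) \<le> 1" if "1 \<le> y" for y
  proof -
    have "of_real y * \<i> \<in> Y" using that by (simp add: Y_def)
    with near X have "dist (\<Sum>(m, n)\<in>X. inverse ((of_int m * (of_real y * \<i>) + of_int n) ^ (2 * l)))
        (eisenstein l (of_real y * \<i>)) < 1"
      by metis
    then show ?thesis unfolding dist_norm t_def by (rule less_imp_le)
  qed
  define u :: "int \<times> int \<Rightarrow> real" where
    "u = (\<lambda>(m, n). if m = 0 then inverse (of_int n ^ (2 * l)) else 0)"
  have t: "((\<lambda>y. t y p) \<longlongrightarrow> of_real (u p)) at_top" for p
  proof (cases p)
    case (Pair m n)
    show ?thesis
    proof (cases "m = 0")
      case True
      then show ?thesis by (simp add: Pair t_def u_def)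
    next
      case False
      have "filterlim (\<lambda>y::real. of_int m * (of_real y * \<i>) + of_int n :: complex) at_infinity at_top"
      proof (rule filterlim_norm_at_top_imp_at_infinity, rule filterlim_at_top_mono)
        show "filterlim (\<lambda>y::real. y) at_top at_top" by (rule filterlim_ident)
        show "\<forall>\<^sub>F y in at_top. y \<le> norm (of_int m * (of_real y * \<i>) + of_int n :: complex)"
          using eventually_ge_at_top [of 0]
        proof eventually_elim
          case (elim y)
          have "1 \<le> \<bar>real_of_int m\<bar>" using False by linarith
          then have "y \<le> \<bar>of_int m\<bar> * y" using elim by (simp add: mult_le_cancel_right1)
          also have "\<dots> = \<bar>Im (of_int m * (of_real y * \<i>) + of_int n)\<bar>"
            using elim by (simp add: abs_mult)
          also have "\<dots> \<le> norm (of_int m * (of_real y * \<i>) + of_int n :: complex)"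
            by (rule abs_Im_le_cmod)
          finally show ?case .
        qed
      qed
      then have "((\<lambda>y::real. inverse (of_int m * (of_real y * \<i>) + of_int n :: complex)) \<longlongrightarrow> 0) at_top"
        by (rule filterlim_compose [OF tendsto_inverse_0])
      then have "((\<lambda>y::real. inverse (of_int m * (of_real y * \<i>) + of_int n :: complex) ^ (2 * l)) \<longlongrightarrow> 0 ^ (2 * l)) at_top"
        by (rule tendsto_power)
      then have "((\<lambda>y::real. inverse ((of_int m * (of_real y * \<i>) + of_int n :: complex) ^ (2 * l))) \<longlongrightarrow> 0) at_top"
        using l by (simp add: power_inverse power_0_left)
      then show ?thesis using False by (simp add: Pair t_def u_def)
    qed
  qed
  have "((\<lambda>y. (\<Sum>p\<in>X. t y p) - eisenstein l (of_real y * \<i>)) \<longlongrightarrow> (\<Sum>p\<in>X. of_real (u p)) - a 0) at_top"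
    by (intro tendsto_intros t q_expansion_tendsto a)
  then have "norm ((\<Sum>p\<in>X. of_real (u p) :: complex) - a 0) \<le> 1"
    by (rule Lim_norm_ubound [rotated])
       (use close in \<open>auto simp: eventually_at_top_linorder intro!: exI [of _ 1]\<close>)
  then have "\<bar>\<Sum>p\<in>X. u p\<bar> \<le> 1"
    by (simp add: a0 of_real_sum [symmetric] del: of_real_sum)
  moreover have "(\<Sum>p\<in>{(0, 1), (0, - 1)}. u p) \<le> (\<Sum>p\<in>X. u p)"
    using X by (intro sum_mono2) (auto simp: X_def u_def split: prod.splits)
  ultimately show False by (simp add: u_def)
qed

section \<open>Zeros of the Hecke recursion at a prime\<close>

text \<open>The characteristic roots are real, and each step multiplies the absolute value by at
  least half of \<open>\<bar>a\<bar>\<close>; this growth is the induction invariant.\<close>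

lemma recursion_nonzero_of_large_trace:
  fixes y :: "nat \<Rightarrow> int"
  assumes y: "y 0 = 1" "y 1 = a" "\<And>m. y (m + 2) = a * y (m + 1) - P * y m"
    and a: "a \<noteq> 0" and P: "0 \<le> P" "4 * P \<le> a\<^sup>2"
  shows "y n \<noteq> 0"
proof -
  have "y m \<noteq> 0 \<and> \<bar>a\<bar> * \<bar>y m\<bar> \<le> 2 * \<bar>y (m + 1)\<bar>" for m
  proof (induction m)
    case 0
    then show ?case using y by simp
  next
    case (Suc m)
    have "0 < \<bar>a\<bar> * \<bar>y m\<bar>" using a Suc by simp
    then have nz: "y (m + 1) \<noteq> 0" using Suc by auto
    have "4 * (P * \<bar>y m\<bar>) \<le> \<bar>a\<bar> * (\<bar>a\<bar> * \<bar>y m\<bar>)"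
      using mult_right_mono [OF P(2), of "\<bar>y m\<bar>"] by (simp add: power2_eq_square mult_ac)
    also have "\<dots> \<le> \<bar>a\<bar> * (2 * \<bar>y (m + 1)\<bar>)"
      using Suc by (intro mult_left_mono) auto
    finally have 1: "2 * (P * \<bar>y m\<bar>) \<le> \<bar>a\<bar> * \<bar>y (m + 1)\<bar>" by simp
    have "\<bar>a * y (m + 1)\<bar> - \<bar>P * y m\<bar> \<le> \<bar>y (m + 2)\<bar>"
      unfolding y(3) by (rule abs_triangle_ineq2)
    then have "\<bar>a\<bar> * \<bar>y (m + 1)\<bar> - P * \<bar>y m\<bar> \<le> \<bar>y (m + 2)\<bar>"
      using P by (simp add: abs_mult)
    with 1 nz show ?case by simp
  qed
  then show ?thesis by blast
qed

text \<open>The Newton polygon of X^2 - a X + P has two different slopes. Concretely,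
  \<open>y m\<close> divided by \<open>p ^ (v * m)\<close> is congruent to \<open>b ^ m\<close>
  modulo \<open>p\<close>.\<close>

lemma recursion_nonzero_of_small_valuation:
  fixes y :: "nat \<Rightarrow> int" and p :: int
  assumes y: "y 0 = 1" "y 1 = p ^ v * b" "\<And>m. y (m + 2) = p ^ v * b * y (m + 1) - p ^ (2 * v + Suc e) * y m"
    and p: "prime p" and b: "\<not> p dvd b"
  shows "y n \<noteq> 0"
proof -
  have "\<exists>x x'. y m = p ^ (v * m) * x \<and> y (m + 1) = p ^ (v * (m + 1)) * x' \<and> \<not> p dvd x \<and> \<not> p dvd x'" for m
  proof (induction m)
    case 0
    show ?case using y b p by (intro exI [of _ 1] exI [of _ b]) (auto simp: not_prime_unit)
  next
    case (Suc m)
    then obtain x x' where x: "y m = p ^ (v * m) * x" "y (m + 1) = p ^ (v * (m + 1)) * x'" "\<not> p dvd x'"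
      by blast
    have powers: "p ^ (2 * v + Suc e) = p ^ v * p ^ v * p * p ^ e"
      "p ^ (v * (m + 1)) = p ^ v * p ^ (v * m)" "p ^ (v * (m + 2)) = p ^ v * p ^ v * p ^ (v * m)"
      by (simp_all add: mult_2 mult_2_right power_add)
    have "y (m + 2) = p ^ (v * (m + 2)) * (b * x' - p * (p ^ e * x))"
      unfolding y(3) x(1,2) powers by (simp add: algebra_simps)
    moreover have "\<not> p dvd b * x' - p * (p ^ e * x)"
    proof
      assume "p dvd b * x' - p * (p ^ e * x)"
      then have "p dvd (b * x' - p * (p ^ e * x)) + p * (p ^ e * x)"
        by (rule dvd_add) simp
      then show False using b x(3) p by (simp add: prime_dvd_mult_iff)
    qed
    ultimately show ?case using x(2,3) by auto
  qed
  then obtain x where "y n = p ^ (v * n) * x" "\<not> p dvd x" by blast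
  then show ?thesis using p by auto
qed

text \<open>If \<open>a\<^sup>2 < 4 p ^ (k - 1)\<close> while \<open>p\<close> divides \<open>a\<close> at least \<open>k / 2\<close> times, then \<open>p\<close> is
  2 or 3 and \<open>a\<^sup>2 = p ^ k\<close>.\<close>

lemma recursion_zero:
  fixes y :: "nat \<Rightarrow> int" and p :: nat
  assumes y: "y 0 = 1" "y 1 = a" "\<And>m. y (m + 2) = a * y (m + 1) - int p ^ (k - 1) * y m"
    and a: "a \<noteq> 0" and p: "prime p" and k: "even k" "0 < k" and zero: "y n = 0"
  shows "a\<^sup>2 = int p ^ k \<and> (p = 2 \<or> p = 3)"
proof -
  have p': "prime (int p)" using p by simp
  have p2: "2 \<le> int p" using prime_ge_2_nat [OF p] by simp
  have less: "a\<^sup>2 < 4 * int p ^ (k - 1)"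
    using recursion_nonzero_of_large_trace [of y a "int p ^ (k - 1)" n, OF y a] zero by force
  obtain b where b: "a = int p ^ multiplicity (int p) a * b" "\<not> int p dvd b"
    using multiplicity_decompose' [of a "int p"] a p' by (metis not_prime_unit)
  define v where "v = multiplicity (int p) a"
  have "\<not> 2 * v < k"
  proof
    assume "2 * v < k"
    \<comment> \<open>Parity enters here: for even \<open>k\<close>, \<open>2 * v < k\<close> means
      \<open>2 * v \<le> k - 2\<close>, so \<open>k - 1\<close> strictly exceeds
      \<open>2 * v\<close>.\<close>
    then have e: "k - 1 = 2 * v + Suc (k - 2 - 2 * v)" using k by (auto elim!: evenE)
    have a_eq: "a = int p ^ v * b" using b(1) by (simp only: v_def)
    have "y n \<noteq> 0"
      by (rule recursion_nonzero_of_small_valuation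
            [OF y(1) y(2) [unfolded a_eq] y(3) [unfolded a_eq e] p' b(2)])
    then show False using zero by simp
  qed
  then have "int p ^ k dvd int p ^ (2 * v)" by (intro le_imp_power_dvd) simp
  also have "int p ^ (2 * v) dvd a\<^sup>2"
    using b(1) by (metis dvd_triv_left mult.commute power_mult power_mult_distrib v_def)
  finally obtain t where t: "a\<^sup>2 = int p ^ k * t" by (auto elim: dvdE)
  have "0 < a\<^sup>2" using a by simp
  then have t0: "0 < t" using t p2 by (simp add: zero_less_mult_iff)
  have "int p ^ k = int p ^ (k - 1) * int p" using k by (metis power_minus_mult)
  then have "int p ^ (k - 1) * (int p * t) < int p ^ (k - 1) * 4" using less t by (simp add: mult_ac)
  then have pt: "int p * t < 4" using p2 by (subst (asm) mult_less_cancel_left_pos) auto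
  have "2 * t \<le> int p * t" using p2 t0 by (intro mult_right_mono) auto
  then have "t = 1" using pt t0 by linarith
  then show ?thesis using t pt p2 by auto
qed

lemma first_zero_prime:
  fixes F :: "nat \<Rightarrow> int"
  assumes F1: "F 1 = 1" and k: "even k" "0 < k"
    and hecke: "\<And>p j. prime p \<Longrightarrow> F (p * j) + (if p dvd j then int p ^ (k - 1) * F (j div p) else 0) = F p * F j"
    and F2: "(F 2)\<^sup>2 \<noteq> 2 ^ k" and F3: "(F 3)\<^sup>2 \<noteq> 3 ^ k"
    and N: "1 \<le> N" "F N = 0" and least: "\<And>n. 1 \<le> n \<Longrightarrow> n < N \<Longrightarrow> F n \<noteq> 0"
  shows "prime N"
proof -
  have "N \<noteq> 1" using N F1 by auto
  then obtain p where p: "prime p" "p dvd N" using prime_factor_nat by blast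
  have p1: "1 < p" using p prime_gt_1_nat by blast
  obtain r where r: "N = p ^ multiplicity p N * r" "\<not> p dvd r"
    using multiplicity_decompose' [of N p] N p(1) by (metis not_one_le_zero not_prime_unit)
  define m where "m = multiplicity p N"
  have N_eq: "N = p ^ m * r" using r by (simp add: m_def)
  have m0: "0 < m" using p r N_eq by (cases m) auto
  have r0: "0 < r" using N N_eq by (cases r) auto
  have rec: "F (p ^ (i + 2) * r) = F p * F (p ^ (i + 1) * r) - int p ^ (k - 1) * F (p ^ i * r)" for i r
    using hecke [OF p(1), of "p ^ (i + 1) * r"] p1 by (simp add: mult_ac)
  \<comment> \<open>The recursion has order two, so the induction carries two consecutive powers of
    \<open>p\<close>.\<close>
  have mult: "F (p ^ i * r) = F (p ^ i) * F r \<and> F (p ^ (i + 1) * r) = F (p ^ (i + 1)) * F r" for i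
  proof (induction i)
    case 0
    then show ?case using hecke [OF p(1), of r] r(2) F1 by simp
  next
    case (Suc i)
    have "F (p ^ (i + 2) * r) = (F p * F (p ^ (i + 1)) - int p ^ (k - 1) * F (p ^ i)) * F r"
      unfolding rec [of i r] using Suc by (simp add: algebra_simps)
    also have "\<dots> = F (p ^ (i + 2)) * F r" using rec [of i 1] by simp
    finally show ?case using Suc by simp
  qed
  have "r = 1"
  proof (rule ccontr)
    assume "r \<noteq> 1"
    then have "1 < r" using r0 by simp
    have "1 < p ^ m" using p1 m0 by (rule one_less_power)
    have "p ^ m < N" "r < N"
      using \<open>1 < r\<close> \<open>1 < p ^ m\<close> p1 unfolding N_eq by simp_all
    then have "F (p ^ m) \<noteq> 0" "F r \<noteq> 0"
      using \<open>1 < r\<close> \<open>1 < p ^ m\<close> least by simp_all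
    then show False using mult [of m] N N_eq by simp
  qed
  then have Np: "N = p ^ m" using N_eq by simp
  show ?thesis
  proof (cases "m = 1")
    case True
    then show ?thesis using Np p by simp
  next
    case False
    then have "p ^ 1 < N" unfolding Np using m0 p1 by (intro power_strict_increasing) auto
    then have "F p \<noteq> 0" using p1 by (intro least) auto
    then have "(F p)\<^sup>2 = int p ^ k \<and> (p = 2 \<or> p = 3)"
      by (rule recursion_zero [of "\<lambda>i. F (p ^ i)", rotated 3])
         (use F1 rec [of _ 1] p(1) k N Np in auto)
    then show ?thesis using F2 F3 by auto
  qed
qed

section \<open>Integrality of the Fourier coefficients\<close>

lemma twelve_dvd_power_diff: "12 dvd (p :: int) ^ 3 - p ^ 5"
proof -
  have "p mod 12 \<in> {0, 1, 2, 3, 4, 5, 6, 7, 8, 9, 10, 11}"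
    unfolding insert_iff empty_iff by presburger
  then have "((p mod 12) ^ 3 - (p mod 12) ^ 5) mod 12 = 0" by auto
  moreover have "((p mod 12) ^ 3 - (p mod 12) ^ 5) mod 12 = (p ^ 3 - p ^ 5) mod 12"
    by (intro mod_diff_cong power_mod)
  ultimately show ?thesis by (intro mod_0_imp_dvd) simp
qed

text \<open>The two sequences turn out to be the divisor sums \<open>\<sigma>\<^sub>3\<close> and \<open>\<sigma>\<^sub>5\<close>, but only their
  integrality and the congruence are needed.\<close>

lemma divisor_sum_recursion:
  fixes e e' :: "nat \<Rightarrow> complex"
  assumes e: "\<And>p j. prime p \<Longrightarrow> hecke_coeff 4 p e j = (1 + of_nat p ^ 3) * e j"
    and e': "\<And>p j. prime p \<Longrightarrow> hecke_coeff 6 p e' j = (1 + of_nat p ^ 5) * e' j"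
    and j: "0 < j"
  shows "\<exists>s t :: int. e j = e 1 * of_int s \<and> e' j = e' 1 * of_int t \<and> 12 dvd s - t"
  using j
proof (induction j rule: less_induct)
  case (less j)
  show ?case
  proof (cases "j = 1")
    case True
    then show ?thesis by (intro exI [of _ 1]) auto
  next
    case False
    then obtain p where p: "prime p" "p dvd j" using prime_factor_nat by blast
    then obtain i where i: "j = p * i" by auto
    have p1: "1 < p" using p prime_gt_1_nat by blast
    have i0: "0 < i" "i < j" using less.prems p1 unfolding i by auto
    obtain s t where st: "e i = e 1 * of_int s" "e' i = e' 1 * of_int t" "12 dvd s - t"
      using less.IH [OF i0(2,1)] by blast
    \<comment> \<open>If \<open>p\<close> does not divide \<open>i\<close>, the second term is
      absent and both integers are 0.\<close>
    obtain s' t' :: int where st': "(if p dvd i then e (i div p) else 0) = e 1 * of_int s'"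
      "(if p dvd i then e' (i div p) else 0) = e' 1 * of_int t'" "12 dvd s' - t'"
    proof (cases "p dvd i")
      case True
      then have "0 < i div p" "i div p < j" using i0 p1 by (auto simp: dvd_div_eq_0_iff intro: le_less_trans [OF div_le_dividend])
      then show ?thesis using less.IH [of "i div p"] True that by auto
    next
      case False
      then show ?thesis using that [of 0 0] by simp
    qed
    define P :: int where "P = int p"
    have "e j = (1 + of_nat p ^ 3) * e i - of_nat p ^ 3 * (if p dvd i then e (i div p) else 0)"
      using e [OF p(1), of i] by (auto simp: hecke_coeff_def i algebra_simps)
    then have 1: "e j = e 1 * of_int ((1 + P ^ 3) * s - P ^ 3 * s')"
      unfolding st st' by (simp add: P_def algebra_simps)
    have "e' j = (1 + of_nat p ^ 5) * e' i - of_nat p ^ 5 * (if p dvd i then e' (i div p) else 0)"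
      using e' [OF p(1), of i] by (auto simp: hecke_coeff_def i algebra_simps)
    then have 2: "e' j = e' 1 * of_int ((1 + P ^ 5) * t - P ^ 5 * t')"
      unfolding st st' by (simp add: P_def algebra_simps)
    \<comment> \<open>The regrouping displays three multiples of 12: two by induction, the last
      since \<open>P ^ 3\<close> and \<open>P ^ 5\<close> agree modulo 12.\<close>
    have "((1 + P ^ 3) * s - P ^ 3 * s') - ((1 + P ^ 5) * t - P ^ 5 * t') =
        (1 + P ^ 3) * (s - t) - P ^ 3 * (s' - t') + (P ^ 3 - P ^ 5) * (t - t')"
      by (simp add: algebra_simps)
    also have "12 dvd \<dots>"
      by (intro dvd_add dvd_diff dvd_mult st(3) st'(3) dvd_mult2 twelve_dvd_power_diff)
    finally show ?thesis using 1 2 by blast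
  qed
qed

section \<open>The coefficients of E_4 and E_6\<close>

lemma eisenstein_normalized:
  assumes "2 \<le> l"
  obtains E e where "E \<in> modular_forms (2 * l)" "has_q_expansion E e" "e 0 = 1"
proof -
  note M = eisenstein_modular_form [OF assms]
  obtain a where a: "has_q_expansion (eisenstein l) a"
    using M by (auto simp: modular_forms_def)
  define c where "c = inverse (a 0)"
  have "c * a 0 = 1" using eisenstein_constant_term [OF assms a] by (simp add: c_def)
  moreover have "(\<lambda>z. c * eisenstein l z) \<in> modular_forms (2 * l)"
    using M has_q_expansion_cmult [of "eisenstein l" _ c] unfolding modular_forms_def
    by (auto simp: mult_ac intro!: holomorphic_intros)
  ultimately show thesis using that has_q_expansion_cmult [OF a] by blast
qed

lemma eisenstein_linear_coeff_nonzero: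
  assumes E: "E \<in> modular_forms 4" and e: "has_q_expansion E e" "e 0 = 1"
    and multiple: "\<And>j. 0 < j \<Longrightarrow> \<exists>s. e j = e 1 * of_int s"
  shows "e 1 \<noteq> 0"
proof
  assume "e 1 = 0"
  then have e0: "e j = (if j = 0 then 1 else 0)" for j using multiple [of j] e(2) by auto
  have E1: "E z = 1" if "z \<in> upper_half_plane" for z
  proof -
    have "(\<lambda>n. e n * nome z ^ n) sums E z" using e(1) that by (simp add: has_q_expansion_nome)
    moreover have "(\<lambda>n. e n * nome z ^ n) = (\<lambda>n. if n = 0 then 1 else 0)"
      by (auto simp: e0)
    ultimately show ?thesis using sums_single [of 0 "\<lambda>_. 1 :: complex"] sums_unique2 by metis
  qed
  \<comment> \<open>With \<open>e 1 = 0\<close> the form would be constant, which weight 4 forbids.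
    The point \<open>\<i>\<close> would not show this, as its automorphy factor is 1; at
    \<open>2 * \<i>\<close> the factor is 16.\<close>
  have z: "2 * \<i> \<in> upper_half_plane" by (simp add: upper_half_plane_def)
  have "E (- 1 / (2 * \<i>)) = (2 * \<i>) ^ 4 * E (2 * \<i>)"
    by (rule modular_form_inversion [OF E z])
  then have "(2 * \<i>) ^ 4 = 1"
    using E1 [OF z] E1 [OF minus_inverse_in_upper_half_plane [OF z]] by simp
  then show False by (simp add: power_mult_distrib)
qed

text \<open>The T_2 equation for the coefficient of E_4^2 at 1 is quadratic in
  \<open>c = e 1\<close>, with roots 0 and 240. The one for E_4 E_6 is then linear in
  \<open>d = e' 1\<close>. The values at 2 and 3 are sigma_3 and sigma_5.\<close>

lemma eisenstein_values:
  assumes E: "E \<in> modular_forms 4" "has_q_expansion E e" "e 0 = 1"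
    and E': "E' \<in> modular_forms 6" "has_q_expansion E' e'" "e' 0 = 1"
  obtains s t :: "nat \<Rightarrow> int"
  where "\<And>j. 0 < j \<Longrightarrow> e j = 240 * of_int (s j)" "\<And>j. 0 < j \<Longrightarrow> e' j = - 504 * of_int (t j)"
    "\<And>j. 0 < j \<Longrightarrow> 12 dvd s j - t j"
    "s 1 = 1" "t 1 = 1" "s 2 = 9" "t 2 = 33" "s 3 = 28" "t 3 = 244"
proof -
  have h4: "hecke_coeff 4 p e j = (1 + of_nat p ^ 3) * e j" if "prime p" for p j
    using eigenform_of_small_weight [of E 2 e p j] E that by simp
  have h6: "hecke_coeff 6 p e' j = (1 + of_nat p ^ 5) * e' j" if "prime p" for p j
    using eigenform_of_small_weight [of E' 3 e' p j] E' that by simp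
  define c d where "c = e 1" "d = e' 1"
  have "\<forall>j. \<exists>s t :: int. 0 < j \<longrightarrow> e j = c * of_int s \<and> e' j = d * of_int t \<and> 12 dvd s - t"
    using divisor_sum_recursion [of e e', OF h4 h6] unfolding c_d_def by blast
  then obtain s t :: "nat \<Rightarrow> int" where st: "\<And>j. 0 < j \<Longrightarrow> e j = c * of_int (s j)"
      "\<And>j. 0 < j \<Longrightarrow> e' j = d * of_int (t j)" "\<And>j. 0 < j \<Longrightarrow> 12 dvd s j - t j"
    by metis
  have "\<exists>s. e j = e 1 * of_int s" if "0 < j" for j
    unfolding c_d_def(1) [symmetric] using st(1) [OF that] by blast
  then have c0: "c \<noteq> 0"
    unfolding c_d_def(1) by (rule eisenstein_linear_coeff_nonzero [OF E])
  have one: "e (Suc 0) = c" "e' (Suc 0) = d" by (simp_all add: c_d_def)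
  have two: "e 2 = 9 * c" "e' 2 = 33 * d" and three: "e 3 = 28 * c" "e' 3 = 244 * d"
    using h4 [of 2 1] h6 [of 2 1] h4 [of 3 1] h6 [of 3 1] by (simp_all add: hecke_coeff_def c_d_def)
  have sum1: "(\<Sum>i\<le>1. u i * w (1 - i)) = u 0 * w 1 + u 1 * w 0"
    and sum2: "(\<Sum>i\<le>2. u i * w (2 - i)) = u 0 * w 2 + u 1 * w 1 + u 2 * w 0" for u w :: "nat \<Rightarrow> complex"
    by (simp_all add: atMost_nat_numeral atMost_Suc numeral_2_eq_2)
  have "hecke_coeff 8 2 (\<lambda>n. \<Sum>i\<le>n. e i * e (n - i)) 1 = (1 + 2 ^ 7) * (\<Sum>i\<le>1. e i * e (1 - i))"
    using eigenform_of_small_weight [of "\<lambda>z. E z * E z" 4 _ 2 1, OF _ has_q_expansion_mult [OF E(2) E(2)]]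
      modular_forms_mult [OF E(1) E(1)] by simp
  then have "2 * (9 * c) + c\<^sup>2 = 129 * (2 * c)"
    unfolding hecke_coeff_def sum1
    by (simp add: sum2 two E one power2_eq_square)
  then have "c * (c - 240) = 0" by (simp add: algebra_simps power2_eq_square)
  then have c: "c = 240" using c0 by simp
  have "hecke_coeff 10 2 (\<lambda>n. \<Sum>i\<le>n. e i * e' (n - i)) 1 = (1 + 2 ^ 9) * (\<Sum>i\<le>1. e i * e' (1 - i))"
    using eigenform_of_small_weight [of "\<lambda>z. E z * E' z" 5 _ 2 1, OF _ has_q_expansion_mult [OF E(2) E'(2)]]
      modular_forms_mult [OF E(1) E'(1)] by simp
  then have "9 * c + c * d + 33 * d = 513 * (c + d)"
    unfolding hecke_coeff_def sum1
    by (simp add: sum2 two E E' one)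
  then have "240 * (d + 504) = 0" by (simp add: c algebra_simps)
  then have "d + 504 = 0" by (subst (asm) mult_eq_0_iff) simp
  then have d: "d = - 504" by (simp only: eq_neg_iff_add_eq_0)
  show thesis
  proof (rule that)
    show "e j = 240 * of_int (s j)" "e' j = - 504 * of_int (t j)" "12 dvd s j - t j" if "0 < j" for j
      using st that c d by auto
    have "(of_int (s 1) :: complex) = 1" using st(1) [of 1] c0 by (simp add: c_d_def)
    then show "s 1 = 1" by (simp only: of_int_eq_1_iff)
    have "(of_int (t 1) :: complex) = 1" using st(2) [of 1] d by (simp add: c_d_def)
    then show "t 1 = 1" by (simp only: of_int_eq_1_iff)
    have "(of_int (s 2) :: complex) = of_int 9" using st(1) [of 2] two c0 by simp
    then show "s 2 = 9" by (simp only: of_int_eq_iff)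
    have "(of_int (t 2) :: complex) = of_int 33" using st(2) [of 2] two d by simp
    then show "t 2 = 33" by (simp only: of_int_eq_iff)
    have "(of_int (s 3) :: complex) = of_int 28" using st(1) [of 3] three c0 by simp
    then show "s 3 = 28" by (simp only: of_int_eq_iff)
    have "(of_int (t 3) :: complex) = of_int 244" using st(2) [of 3] three d by simp
    then show "t 3 = 244" by (simp only: of_int_eq_iff)
  qed
qed

lemma fps_numeral_mult_nth: "fps_nth (numeral w * F) n = numeral w * fps_nth F n"
  for F :: "int fps"
  by (simp add: fps_numeral_fps_const)

section \<open>The integral model of Delta_k\<close>

text \<open>Integer power series turn congruences between expansions into ring identities.\<close>

abbreviation int_q_expansion :: "(complex \<Rightarrow> complex) \<Rightarrow> int fps \<Rightarrow> bool" where
  "int_q_expansion f F \<equiv> has_q_expansion f (\<lambda>n. of_int (fps_nth F n))"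

lemma int_q_expansion_mult:
  assumes "int_q_expansion f F" "int_q_expansion g G"
  shows "int_q_expansion (\<lambda>z. f z * g z) (F * G)"
  using has_q_expansion_mult [OF assms] by (simp add: fps_mult_nth atLeast0AtMost)

lemma int_q_expansion_power:
  assumes "int_q_expansion f F"
  shows "int_q_expansion (\<lambda>z. f z ^ n) (F ^ n)"
proof (induction n)
  case 0
  have "(\<lambda>n. of_int (fps_nth 1 n) * w ^ n) sums 1" for w :: complex
    using sums_single [of 0 "\<lambda>_. 1 :: complex"] by (rule sums_cong [THEN iffD1, rotated]) auto
  then show ?case by (simp add: has_q_expansion_def)
next
  case (Suc n)
  then show ?case using int_q_expansion_mult [OF assms Suc] by simp
qed

lemma congruent_1_mod_6_power:
  fixes A B :: "int fps"
  shows "\<exists>R. (1 + 6 * A) ^ i * (1 + 6 * B) ^ j = 1 + 6 * R"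
proof -
  have mult: "\<exists>R. X * Y = 1 + 6 * R" if XY: "\<exists>R. X = 1 + 6 * R" "\<exists>R. Y = 1 + 6 * R" for X Y :: "int fps"
  proof -
    obtain R S where "X = 1 + 6 * R" "Y = 1 + 6 * S" using XY by blast
    then have "X * Y = 1 + 6 * (R + S + 6 * R * S)" by (simp add: algebra_simps)
    then show ?thesis by blast
  qed
  have power: "\<exists>R. (1 + 6 * C) ^ n = 1 + 6 * R" for C :: "int fps" and n
  proof (induction n)
    case 0
    then show ?case by (intro exI [of _ 0]) simp
  next
    case (Suc n)
    then show ?case using mult [of "1 + 6 * C"] by auto
  qed
  show ?thesis by (intro mult power)
qed

lemma cusp_form_integral:
  assumes f: "f \<in> modular_forms k" and a: "has_q_expansion f a" "a 0 = 0" "a 1 = 1"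
    and k: "k \<in> {12, 16, 18, 20, 22, 26}"
  obtains F :: "nat \<Rightarrow> int" where "\<And>n. a n = of_int (F n)" "3 dvd F 2" "2 dvd F 3"
proof -
  obtain E e where E: "E \<in> modular_forms 4" "has_q_expansion E e" "e 0 = 1"
    using eisenstein_normalized [of 2] by auto
  obtain E' e' where E': "E' \<in> modular_forms 6" "has_q_expansion E' e'" "e' 0 = 1"
    using eisenstein_normalized [of 3] by auto
  obtain s t :: "nat \<Rightarrow> int" where st:
    "\<And>j. 0 < j \<Longrightarrow> e j = 240 * of_int (s j)" "\<And>j. 0 < j \<Longrightarrow> e' j = - 504 * of_int (t j)"
    "\<And>j. 0 < j \<Longrightarrow> 12 dvd s j - t j"
    "s 1 = 1" "t 1 = 1" "s 2 = 9" "t 2 = 33" "s 3 = 28" "t 3 = 244"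
    using eisenstein_values [OF E E'] by blast
  \<comment> \<open>\<open>U\<close> is (5 A + 7 B) / 12, written as A - 7 (A - B) / 12 so that the
    divisibility of \<open>s n - t n\<close> by 12 is what makes it integral.\<close>
  define A B U :: "int fps" where "A = Abs_fps (\<lambda>n. if n = 0 then 0 else s n)"
    "B = Abs_fps (\<lambda>n. if n = 0 then 0 else t n)"
    "U = Abs_fps (\<lambda>n. if n = 0 then 0 else s n - 7 * ((s n - t n) div 12))"
  note defs = this
  have U: "12 * U = 5 * A + 7 * B"
  proof (rule fps_ext)
    fix n
    show "fps_nth (12 * U) n = fps_nth (5 * A + 7 * B) n"
    proof (cases "n = 0")
      case False
      then have "12 * ((s n - t n) div 12) = s n - t n" using st(3) by auto
      then show ?thesis using False by (simp add: defs fps_numeral_mult_nth algebra_simps)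
    qed (simp add: defs)
  qed
  \<comment> \<open>The linear part of E_4^3 - E_6^2 is 720 A + 1008 B = 144 (5 A + 7 B) = 1728 U;
    the other coefficients are divisible by 1728 outright.\<close>
  define D where "D = U + 100 * A\<^sup>2 + 8000 * A ^ 3 - 147 * B\<^sup>2"
  have D: "(1 + 240 * A) ^ 3 - (1 - 504 * B)\<^sup>2 = 1728 * D"
  proof -
    have "1728 * D = 144 * (12 * U) + 172800 * A\<^sup>2 + 13824000 * A ^ 3 - 254016 * B\<^sup>2"
      by (simp add: D_def algebra_simps)
    also have "\<dots> = (1 + 240 * A) ^ 3 - (1 - 504 * B)\<^sup>2"
      unfolding U by (simp add: algebra_simps power2_eq_square power3_eq_cube)
    finally show ?thesis by simp
  qed
  have q: "int_q_expansion E (1 + 240 * A)" "int_q_expansion E' (1 - 504 * B)"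
  proof -
    have "e n = of_int (fps_nth (1 + 240 * A) n)" "e' n = of_int (fps_nth (1 - 504 * B) n)" for n
      using st(1,2) [of n] E(3) E'(3) by (cases "n = 0"; simp add: defs fps_numeral_mult_nth)+
    then have "e = (\<lambda>n. of_int (fps_nth (1 + 240 * A) n))" "e' = (\<lambda>n. of_int (fps_nth (1 - 504 * B) n))"
      by blast+
    then show "int_q_expansion E (1 + 240 * A)" "int_q_expansion E' (1 - 504 * B)"
      using E(2) E'(2) by simp_all
  qed
  \<comment> \<open>The weights left beside the factor of weight 12 are 0, 4, 6, 8, 4 + 6 and 8 +
    6.\<close>
  have "\<exists>i j. k = 12 + 4 * i + 6 * j"
    using k by (auto intro: exI [of _ "0::nat"] exI [of _ "1::nat"] exI [of _ "2::nat"]; presburger)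
  then obtain i j where ij: "k = 12 + 4 * i + 6 * j" by blast
  define G where "G = D * ((1 + 240 * A) ^ i * (1 - 504 * B) ^ j)"
  define g where "g z = (E z ^ 3 - E' z ^ 2) * (E z ^ i * E' z ^ j) / 1728" for z
  have g: "int_q_expansion g G"
  proof -
    have "int_q_expansion (\<lambda>z. E z ^ 3 - E' z ^ 2) ((1 + 240 * A) ^ 3 - (1 - 504 * B)\<^sup>2)"
      using has_q_expansion_diff [OF int_q_expansion_power [OF q(1), of 3] int_q_expansion_power [OF q(2), of 2]]
      by simp
    then have "int_q_expansion (\<lambda>z. E z ^ 3 - E' z ^ 2) (1728 * D)" by (simp only: D)
    then have "int_q_expansion (\<lambda>z. (E z ^ 3 - E' z ^ 2) * (E z ^ i * E' z ^ j)) (1728 * G)"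
      unfolding G_def mult.assoc [symmetric, of 1728]
      by (rule int_q_expansion_mult [OF _ int_q_expansion_mult
            [OF int_q_expansion_power [OF q(1)] int_q_expansion_power [OF q(2)]]])
    from has_q_expansion_cmult [OF this, of "1 / 1728"] show ?thesis
      by (simp add: g_def [abs_def] fps_numeral_mult_nth)
  qed
  have g_inv: "g (- 1 / z) = z ^ k * g z" if "z \<in> upper_half_plane" for z
  proof -
    have zk: "z ^ k = z ^ 12 * ((z ^ 4) ^ i * (z ^ 6) ^ j)" by (simp add: ij power_add power_mult)
    have z12: "(z ^ 4) ^ 3 = z ^ 12" "(z ^ 6)\<^sup>2 = z ^ 12" by (simp_all add: power_mult [symmetric])
    show ?thesis
      unfolding g_def modular_form_inversion [OF E(1) that] modular_form_inversion [OF E'(1) that]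
        zk power_mult_distrib z12
      by (simp only: mult_ac times_divide_eq_left times_divide_eq_right right_diff_distrib left_diff_distrib)
  qed
  have s0: "fps_nth A 0 = 0" "fps_nth B 0 = 0" "fps_nth U 0 = 0" "fps_nth A 1 = 1" "fps_nth B 1 = 1"
    "fps_nth A 2 = 9" "fps_nth B 2 = 33" "fps_nth U 1 = 1" "fps_nth U 2 = 23" "fps_nth U 3 = 154"
    using st(4-9) by (simp_all add: defs)
  have sq: "fps_nth (X\<^sup>2) 0 = 0" "fps_nth (X\<^sup>2) 1 = 0" "fps_nth (X\<^sup>2) 2 = (fps_nth X 1)\<^sup>2"
    "fps_nth (X\<^sup>2) 3 = 2 * fps_nth X 1 * fps_nth X 2"
    "fps_nth (X ^ 3) 0 = 0" "fps_nth (X ^ 3) 1 = 0" "fps_nth (X ^ 3) 2 = 0" "fps_nth (X ^ 3) 3 = (fps_nth X 1) ^ 3"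
    if "fps_nth X 0 = 0" for X :: "int fps"
    using that
    by (simp_all add: power2_eq_square power3_eq_cube fps_mult_nth atLeast0_atMost_Suc numeral_2_eq_2 numeral_3_eq_3)
  \<comment> \<open>The values -24 and 252 of Ramanujan's tau at 2 and 3 are divisible by 6, and
    multiplication by the Eisenstein factors alters them by multiples of 6 only.\<close>
  have D0: "fps_nth D 0 = 0" "fps_nth D 1 = 1" "fps_nth D 2 = - 24" "fps_nth D 3 = 252"
    by (simp_all add: D_def fps_numeral_mult_nth sq [unfolded One_nat_def] s0 [unfolded One_nat_def])
  obtain R where R: "(1 + 240 * A) ^ i * (1 - 504 * B) ^ j = 1 + 6 * R"
    using congruent_1_mod_6_power [of "40 * A" i "- 84 * B" j] by (auto simp: algebra_simps)
  have "fps_nth ((1 + 240 * A) ^ i * (1 - 504 * B) ^ j) 0 = 1"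
    by (simp add: fps_power_zeroth s0)
  then have R0: "fps_nth R 0 = 0" unfolding R by simp
  have GR: "fps_nth G n = fps_nth D n + 6 * fps_nth (D * R) n" for n
    by (simp add: G_def R distrib_left mult.left_commute [of D] fps_numeral_mult_nth)
  have G01: "fps_nth G 0 = 0" "fps_nth G 1 = 1"
    unfolding GR by (simp_all add: fps_mult_nth D0 [unfolded One_nat_def] R0)
  show thesis
  proof (rule that)
    fix n
    have "a n - of_int (fps_nth G n) = 0"
    proof (rule vanishing_order_2 [OF has_q_expansion_diff [OF a(1) g] _ _ _ k])
      show "f (- 1 / z) - g (- 1 / z) = z ^ k * (f z - g z)" if "z \<in> upper_half_plane" for z
        using modular_form_inversion [OF f that] g_inv [OF that] by (simp add: algebra_simps)
    qed (use a G01 in simp_all)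
    then show "a n = of_int (fps_nth G n)" by simp
    show "3 dvd fps_nth G 2" "2 dvd fps_nth G 3"
      unfolding GR D0 by presburger+
  qed
qed

theorem corollary2p2:
  fixes k :: nat and \<Delta> :: "complex \<Rightarrow> complex" and a :: "nat \<Rightarrow> complex"
  assumes "k \<in> {12, 16, 18, 20, 22, 26}"
    and "\<Delta> \<in> cusp_forms k"
    and "has_q_expansion \<Delta> a"
    and "a 1 = 1"
    and "{n. n \<ge> 1 \<and> a n = 0} \<noteq> {}"
  shows "prime (LEAST n. n \<ge> 1 \<and> a n = 0)"
proof -
  \<comment> \<open>A cusp form has some expansion with constant term 0; uniqueness identifies it
    with \<open>a\<close>.\<close>
  have form: "\<Delta> \<in> modular_forms k" and a0: "a 0 = 0"
    using assms(2) q_expansion_unique [OF assms(3)] by (auto simp: cusp_forms_def)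
  obtain F :: "nat \<Rightarrow> int" where F: "\<And>n. a n = of_int (F n)" "3 dvd F 2" "2 dvd F 3"
    using cusp_form_integral [OF form assms(3) a0 assms(4,1)] by blast
  define N where "N = (LEAST n. n \<ge> 1 \<and> a n = 0)"
  have N: "N \<ge> 1 \<and> a N = 0"
    unfolding N_def by (rule LeastI_ex) (use assms(5) in blast)
  have "prime N"
  proof (rule first_zero_prime [of F k])
    show "F 1 = 1" using F(1) [of 1] assms(4) by simp
    show "even k" "0 < k" using assms(1) by auto
    show "F (p * j) + (if p dvd j then int p ^ (k - 1) * F (j div p) else 0) = F p * F j"
      if "prime p" for p j
    proof -
      have "(of_int (F (p * j) + (if p dvd j then int p ^ (k - 1) * F (j div p) else 0)) :: complex) = of_int (F p * F j)"
        using cusp_eigenform [OF form assms(3) a0 assms(4,1) that, of j]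
        by (cases "p dvd j") (simp_all add: hecke_coeff_def F(1))
      then show ?thesis by (simp only: of_int_eq_iff)
    qed
    show "(F 2)\<^sup>2 \<noteq> 2 ^ k"
    proof
      assume "(F 2)\<^sup>2 = 2 ^ k"
      moreover have "3 dvd (F 2)\<^sup>2" using F(2) by (simp add: power2_eq_square)
      ultimately have "(3::int) dvd 2 ^ k" by simp
      then have "(3::int) dvd 2" by (rule prime_dvd_power [rotated]) simp
      then show False by simp
    qed
    show "(F 3)\<^sup>2 \<noteq> 3 ^ k"
    proof
      assume "(F 3)\<^sup>2 = 3 ^ k"
      moreover have "2 dvd (F 3)\<^sup>2" using F(3) by (simp add: power2_eq_square)
      ultimately have "(2::int) dvd 3 ^ k" by simp
      then show False by simp
    qed
    show "1 \<le> N" "F N = 0" using N F(1) [of N] by auto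
    show "F n \<noteq> 0" if "1 \<le> n" "n < N" for n
      using not_less_Least [of n "\<lambda>n. n \<ge> 1 \<and> a n = 0"] that F(1) [of n] by (auto simp: N_def)
  qed
  then show ?thesis by (simp add: N_def)
qed

end
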